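(* Let $X$ be a Banach space, $f:X\to\mathbb{R}\cup\{+\infty\}$ lower semicontinuous and $\bar x\in[f\le0]$. Let $\tau>0$ and $\delta\in(0,\infty]$. Suppose that either $X$ is Asplund or $f$ is convex, and $$d(0,\partial f(x))\ge\tau\quad\text{for all } x\in B_\delta(\bar x)\cap[f>0]\text{ with } f(x)<\tau\, d(x,[f\le0]).$$ Then $\alpha\tau\, d(x,[f\le0])\le f_+(x)$ for all $\alpha\in(0,1]$ and all $x\in B_{\delta/(1+\alpha)}(\bar x)$.
   Context: $[f\le0]=\{x: f(x)\le0\}$, $[f>0]=\{x:f(x)>0\}$, $f_+(x)=\max\{f(x),0\}$. $B_\delta(x)$ is the open ball of radius $\delta$ centered at $x$ ($B_\infty(x)=X$). $d(x,A)=\inf_{a\in A}\|x-a\|$ with $d(x,\emptyset)=+\infty$. $\partial f(x)$ is the Fréchet subdifferential: $\{x^*\in X^*:\liminf_{y\to x}\frac{f(y)-f(x)-\langle x^*,y-x\rangle}{\|y-x\|}\ge0\}$ if $f(x)<+\infty$, and $\emptyset$ otherwise (it coincides with the convex subdifferential for convex $f$); $d(0,\partial f(x))=\inf\{\|x^*\|: x^*\in\partial f(x)\}$ ($=+\infty$ if empty). A Banach space is Asplund if every continuous convex function on an open convex subset is Fréchet differentiable on a dense subset. *)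

theory Defs
  imports "HOL-Analysis.Analysis" "HOL-Library.Extended_Real"
begin

definition ereal_lsc :: "('a::topological_space \<Rightarrow> ereal) \<Rightarrow> bool" where
  "ereal_lsc f \<longleftrightarrow> (\<forall>x. f x \<le> Liminf (at x) f)"

definition ereal_convex :: "('a::real_vector \<Rightarrow> ereal) \<Rightarrow> bool" where
  "ereal_convex f \<longleftrightarrow> (\<forall>x y t. 0 \<le> t \<and> t \<le> 1 \<longrightarrow>
      f ((1 - t) *\<^sub>R x + t *\<^sub>R y) \<le> ereal (1 - t) * f x + ereal t * f y)"

definition frechet_subdiff :: "('a::real_normed_vector \<Rightarrow> ereal) \<Rightarrow> 'a \<Rightarrow> ('a \<Rightarrow>\<^sub>L real) set" where
  "frechet_subdiff f x =
     (if f x < \<infinity> then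
        {xs. Liminf (at x) (\<lambda>y. (f y - f x - ereal (blinfun_apply xs (y - x))) / ereal (norm (y - x))) \<ge> 0}
      else {})"

text \<open>Distance to a set, with the convention d(x, {}) = +infinity.\<close>
definition setdist_e :: "'a::metric_space \<Rightarrow> 'a set \<Rightarrow> ereal" where
  "setdist_e x A = (INF a\<in>A. ereal (dist x a))"

text \<open>d(0, subdifferential), +infinity if the subdifferential is empty.\<close>
definition subdiff_dist0 :: "('a::real_normed_vector \<Rightarrow> ereal) \<Rightarrow> 'a \<Rightarrow> ereal" where
  "subdiff_dist0 f x = (INF xs\<in>frechet_subdiff f x. ereal (norm xs))"

definition asplund :: "'a::real_normed_vector itself \<Rightarrow> bool" where
  "asplund (_::'a itself) \<longleftrightarrow>
     (\<forall>(U::'a set) (g::'a \<Rightarrow> real). open U \<and> convex U \<and> convex_on U g \<and> continuous_on U g \<longrightarrow>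
        (\<exists>D \<subseteq> U. U \<subseteq> closure D \<and> (\<forall>x\<in>D. g differentiable (at x))))"

definition eball :: "'a::metric_space \<Rightarrow> ereal \<Rightarrow> 'a set" where
  "eball c r = {x. ereal (dist c x) < r}"

end

theory Submission
  imports Defs
begin

text \<open>
  Suppose the estimate fails at \<open>x0\<close>. A variational principle of Ekeland and Borwein-Preiss type gives
  a point \<open>x\<close> near \<open>x0\<close> minimising \<open>f\<^sub>+ + q\<close>, where \<open>q\<close> has Lipschitz constant below \<open>\<tau>\<close>, and \<open>x\<close>
  violates the slope hypothesis as soon as \<open>f\<^sub>+\<close> has a Frechet subgradient there of norm below \<open>\<tau>\<close>.
  For convex \<open>f\<close> the Hahn-Banach theorem supplies it.

  In an Asplund space no smooth \<open>q\<close> is available in general, so one first passes to a separable subspace \<open>Y\<close>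
  that is rich enough for subgradients of the restriction of \<open>f\<^sub>+\<close> to \<open>Y\<close> to yield subgradients of
  \<open>f\<^sub>+\<close> of no larger norm. The Asplund property makes the dual of \<open>Y\<close> separable, and then the norm
  of \<open>Y\<close> is uniformly approximated by Frechet smooth convex functions, from which \<open>q\<close> is built.
\<close>

section \<open>Sublinear functions and the Hahn-Banach theorem\<close>

definition sublinear :: "('a::real_vector \<Rightarrow> real) \<Rightarrow> bool" where
  "sublinear P \<longleftrightarrow> (\<forall>x y. P (x + y) \<le> P x + P y) \<and> (\<forall>t x. 0 \<le> t \<longrightarrow> P (t *\<^sub>R x) = t * P x)"

lemma sublinear_add: "sublinear P \<Longrightarrow> P (x + y) \<le> P x + P y"
  and sublinear_scale: "sublinear P \<Longrightarrow> 0 \<le> t \<Longrightarrow> P (t *\<^sub>R x) = t * P x"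
  by (auto simp: sublinear_def)

lemma sublinear_zero: "sublinear P \<Longrightarrow> P 0 = 0"
  using sublinear_scale[of P 0 0] by simp

lemma sublinear_neg: "sublinear P \<Longrightarrow> - P (- x) \<le> P x"
  using sublinear_add[of P x "- x"] sublinear_zero[of P] by simp

lemma sublinear_diff: "sublinear P \<Longrightarrow> P x - P y \<le> P (x - y)"
  using sublinear_add[of P "x - y" y] by simp

lemma sublinear_norm: "sublinear (norm :: 'a::real_normed_vector \<Rightarrow> real)"
  by (auto simp: sublinear_def norm_triangle_ineq)

lemma sublinear_chain_INF:
  fixes C :: "('a::real_vector \<Rightarrow> real) set"
  assumes ne: "C \<noteq> {}" and sub: "\<And>P. P \<in> C \<Longrightarrow> sublinear P"
    and chain: "\<And>P Q. P \<in> C \<Longrightarrow> Q \<in> C \<Longrightarrow> P \<le> Q \<or> Q \<le> P"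
    and bdd: "\<And>x. bdd_below ((\<lambda>P. P x) ` C)"
  shows "sublinear (\<lambda>x. INF P\<in>C. P x)"
  unfolding sublinear_def
proof (intro conjI allI impI)
  fix x y :: 'a
  let ?I = "\<lambda>x. INF P\<in>C. P x"
  have "?I (x + y) \<le> P x + Q y" if "P \<in> C" "Q \<in> C" for P Q
  proof -
    obtain R where R: "R \<in> C" "R x \<le> P x" "R y \<le> Q y"
      using chain[OF \<open>P \<in> C\<close> \<open>Q \<in> C\<close>] \<open>P \<in> C\<close> \<open>Q \<in> C\<close> by (auto simp: le_fun_def)
    have "?I (x + y) \<le> R (x + y)" by (rule cINF_lower[OF bdd R(1)])
    also have "\<dots> \<le> R x + R y" using sub[OF R(1)] by (rule sublinear_add)
    finally show ?thesis using R by linarith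
  qed
  then have "?I (x + y) - Q y \<le> ?I x" if "Q \<in> C" for Q
    using that ne by (intro cINF_greatest) (auto simp: algebra_simps)
  then have "?I (x + y) - ?I x \<le> ?I y"
    using ne by (intro cINF_greatest) (auto simp: algebra_simps)
  then show "?I (x + y) \<le> ?I x + ?I y" by simp
next
  fix t :: real and x :: 'a
  assume t: "0 \<le> t"
  let ?I = "\<lambda>x. INF P\<in>C. P x"
  have eq: "P (t *\<^sub>R x) = t * P x" if "P \<in> C" for P using sub[OF that] t by (rule sublinear_scale)
  show "?I (t *\<^sub>R x) = t * ?I x"
  proof (cases "t = 0")
    case True
    then have "(\<lambda>P. P (t *\<^sub>R x)) ` C = {0}" using ne eq by (auto simp: image_iff)
    then show ?thesis using True by simp
  next
    case False
    with t have t: "t > 0" by simp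
    show ?thesis
    proof (rule antisym)
      have "?I (t *\<^sub>R x) / t \<le> P x" if "P \<in> C" for P
        using cINF_lower[OF bdd that, of "t *\<^sub>R x"] eq[OF that] t by (simp add: field_simps)
      then have "?I (t *\<^sub>R x) / t \<le> ?I x" using ne by (intro cINF_greatest) auto
      then show "?I (t *\<^sub>R x) \<le> t * ?I x" using t by (simp add: field_simps)
      show "t * ?I x \<le> ?I (t *\<^sub>R x)"
        using ne t cINF_lower[OF bdd, of _ x] by (intro cINF_greatest) (simp_all add: eq)
    qed
  qed
qed

lemma minimal_sublinear:
  fixes P0 :: "'a::real_vector \<Rightarrow> real"
  assumes P0: "sublinear P0" and q: "\<And>y. y \<in> S \<Longrightarrow> q y \<le> P0 y"
  obtains P where "sublinear P" "P \<le> P0" "\<And>y. y \<in> S \<Longrightarrow> q y \<le> P y"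
    "\<And>R. sublinear R \<Longrightarrow> R \<le> P \<Longrightarrow> (\<And>y. y \<in> S \<Longrightarrow> q y \<le> R y) \<Longrightarrow> R = P"
proof -
  define \<A> where "\<A> = {P. sublinear P \<and> P \<le> P0 \<and> (\<forall>y\<in>S. q y \<le> P y)}"
  have "\<exists>P\<in>\<A>. \<forall>R\<in>\<A>. R \<le> P \<longrightarrow> R = P"
  proof (rule predicate_Zorn)
    show "partial_order_on \<A> (relation_of (\<lambda>a b. b \<le> a) \<A>)"
      by (auto simp: partial_order_on_def preorder_on_def refl_on_def trans_def antisym_def relation_of_def)
    fix C assume "C \<in> Chains (relation_of (\<lambda>a b. b \<le> a) \<A>)"
    then have CA: "C \<subseteq> \<A>" and chain: "\<And>P Q. P \<in> C \<Longrightarrow> Q \<in> C \<Longrightarrow> P \<le> Q \<or> Q \<le> P"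
      by (auto simp: Chains_def relation_of_def)
    show "\<exists>u\<in>\<A>. \<forall>a\<in>C. u \<le> a"
    proof (cases "C = {}")
      case True
      then show ?thesis using P0 q by (auto simp: \<A>_def)
    next
      case False
      have low: "- P0 (- x) \<le> P x" if "P \<in> C" for P x
      proof -
        have "sublinear P" "P (- x) \<le> P0 (- x)" using that CA by (auto simp: \<A>_def le_fun_def)
        then show ?thesis using sublinear_neg[of P x] by linarith
      qed
      then have bdd: "bdd_below ((\<lambda>P. P x) ` C)" for x by (intro bdd_belowI2) auto
      let ?I = "\<lambda>x. INF P\<in>C. P x"
      have le: "?I x \<le> P x" if "P \<in> C" for P x by (rule cINF_lower[OF bdd that])
      have "sublinear ?I"
        using False CA chain bdd by (intro sublinear_chain_INF) (auto simp: \<A>_def)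
      moreover have "?I \<le> P0"
      proof -
        obtain P where "P \<in> C" using False by auto
        then have "P \<le> P0" "?I \<le> P" using le CA by (auto simp: \<A>_def le_fun_def)
        then show ?thesis by (rule order_trans[rotated])
      qed
      moreover have "\<forall>y\<in>S. q y \<le> ?I y" using False CA by (auto simp: \<A>_def intro!: cINF_greatest)
      ultimately have "?I \<in> \<A>" by (simp add: \<A>_def)
      then show ?thesis using le by (intro bexI[of _ ?I]) (auto simp: le_fun_def)
    qed
  qed
  then obtain P where "P \<in> \<A>" "\<forall>R\<in>\<A>. R \<le> P \<longrightarrow> R = P" by blast
  then have P: "sublinear P" "P \<le> P0" "\<forall>y\<in>S. q y \<le> P y"
    and min: "\<And>R. sublinear R \<Longrightarrow> R \<le> P0 \<Longrightarrow> \<forall>y\<in>S. q y \<le> R y \<Longrightarrow> R \<le> P \<Longrightarrow> R = P"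
    unfolding \<A>_def by blast+
  show thesis
  proof (rule that[of P])
    show "R = P" if "sublinear R" "R \<le> P" "\<And>y. y \<in> S \<Longrightarrow> q y \<le> R y" for R
      using min[OF that(1) order_trans[OF that(2) P(2)]] that by blast
  qed (use P in auto)
qed

text \<open>If \<open>P\<close> is the support function of \<open>C\<close>, then the function below is the support function of
  \<open>C\<close> with the slice \<open>{c. c x > \<beta>}\<close> cut off.\<close>

lemma sublinear_cut:
  fixes P :: "'a::real_vector \<Rightarrow> real"
  assumes P: "sublinear P" and \<beta>: "0 \<le> P (- x) + \<beta>"
  defines "R \<equiv> \<lambda>z. INF t\<in>{0..}. P (z - t *\<^sub>R x) + t * \<beta>"
  shows "sublinear R" "R \<le> P" "R x \<le> \<beta>"
    and "\<And>z r. R z < r \<Longrightarrow> \<exists>t\<ge>0. P (z - t *\<^sub>R x) + t * \<beta> < r"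
proof -
  have low: "- P (- z) \<le> P (z - t *\<^sub>R x) + t * \<beta>" if "0 \<le> t" for z t
  proof -
    have "0 \<le> t * (P (- x) + \<beta>)" using that \<beta> by simp
    also have "\<dots> = P (t *\<^sub>R (- x)) + t * \<beta>"
      using sublinear_scale[OF P that, of "- x"] by (simp add: algebra_simps)
    also have "P (t *\<^sub>R (- x)) \<le> P (z - t *\<^sub>R x) + P (- z)"
      using sublinear_add[OF P, of "z - t *\<^sub>R x" "- z"] by simp
    finally show ?thesis by simp
  qed
  have bdd: "bdd_below ((\<lambda>t. P (z - t *\<^sub>R x) + t * \<beta>) ` {0..})" for z
    using low by (intro bdd_belowI2) auto
  have le: "R z \<le> P (z - t *\<^sub>R x) + t * \<beta>" if "0 \<le> t" for z t
    unfolding R_def by (rule cINF_lower[OF bdd]) (use that in auto)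
  show ex: "\<exists>t\<ge>0. P (z - t *\<^sub>R x) + t * \<beta> < r" if "R z < r" for z r
    using that unfolding R_def by (subst (asm) cINF_less_iff) (auto simp: bdd)
  show "R \<le> P" using le[of 0] by (simp add: le_fun_def)
  show "R x \<le> \<beta>" using le[of 1 x] sublinear_zero[OF P] by simp
  show "sublinear R"
    unfolding sublinear_def
  proof (intro conjI allI impI)
    fix y z
    show "R (y + z) \<le> R y + R z"
    proof (rule field_le_epsilon)
      fix e :: real assume "e > 0"
      obtain s t where s: "s \<ge> 0" "P (y - s *\<^sub>R x) + s * \<beta> < R y + e / 2"
        and t: "t \<ge> 0" "P (z - t *\<^sub>R x) + t * \<beta> < R z + e / 2"
        using ex[of y "R y + e / 2"] ex[of z "R z + e / 2"] \<open>e > 0\<close> by auto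
      have "R (y + z) \<le> P ((y - s *\<^sub>R x) + (z - t *\<^sub>R x)) + (s + t) * \<beta>"
        using le[of "s + t" "y + z"] s t by (simp add: algebra_simps)
      also have "\<dots> \<le> P (y - s *\<^sub>R x) + P (z - t *\<^sub>R x) + (s + t) * \<beta>"
        using sublinear_add[OF P] by simp
      finally show "R (y + z) \<le> R y + R z + e" using s t by (simp add: algebra_simps)
    qed
  next
    fix a :: real and z assume a: "0 \<le> a"
    have le1: "R (a *\<^sub>R z) \<le> a * R z" if a: "0 < a" for a z
    proof -
      have "R (a *\<^sub>R z) / a \<le> P (z - t *\<^sub>R x) + t * \<beta>" if t: "0 \<le> t" for t
      proof -
        have "R (a *\<^sub>R z) \<le> P (a *\<^sub>R (z - t *\<^sub>R x)) + a * t * \<beta>"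
          using le[of "a * t" "a *\<^sub>R z"] a t by (simp add: algebra_simps)
        also have "\<dots> = a * (P (z - t *\<^sub>R x) + t * \<beta>)"
          using sublinear_scale[OF P, of a "z - t *\<^sub>R x"] a by (simp add: distrib_left)
        finally show ?thesis using a by (simp add: field_simps)
      qed
      then have "R (a *\<^sub>R z) / a \<le> R z" unfolding R_def by (intro cINF_greatest) auto
      then show ?thesis using a by (simp add: field_simps)
    qed
    show "R (a *\<^sub>R z) = a * R z"
    proof (cases "a = 0")
      case True
      have "R 0 \<le> 0" using le[of 0 0] sublinear_zero[OF P] by simp
      moreover have "0 \<le> R 0" unfolding R_def using low[of _ 0] sublinear_zero[OF P]
        by (intro cINF_greatest) auto
      ultimately show ?thesis using True by simp
    next
      case False
      with a have a: "0 < a" by simp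
      have "R z \<le> 1 / a * R (a *\<^sub>R z)" using le1[of "1 / a" "a *\<^sub>R z"] a by simp
      then show ?thesis using le1[OF a, of z] a by (simp add: field_simps)
    qed
  qed
qed

theorem Hahn_Banach_sublinear:
  fixes P :: "'a::real_vector \<Rightarrow> real"
  assumes "sublinear P"
  obtains L where "linear L" "\<And>x. L x \<le> P x"
proof -
  obtain L where L: "sublinear L" "L \<le> P"
    and min: "\<And>R. sublinear R \<Longrightarrow> R \<le> L \<Longrightarrow> R = L"
    by (rule minimal_sublinear[OF assms, of "{}" "\<lambda>_. 0"]) auto
  have neg: "L (- x) = - L x" for x
  proof (rule antisym)
    define R where "R \<equiv> \<lambda>z. INF t\<in>{0..}. L (z - t *\<^sub>R (- x)) + t * (- L x)"
    have R: "sublinear R" "R \<le> L" "R (- x) \<le> - L x"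
      using sublinear_cut[OF L(1), of "- x" "- L x"] unfolding R_def by auto
    then show "L (- x) \<le> - L x" using min by metis
    show "- L x \<le> L (- x)" using sublinear_neg[OF L(1), of x] by simp
  qed
  have "linear L"
  proof (rule linearI)
    show "L (x + y) = L x + L y" for x y
      using sublinear_add[OF L(1), of x y] sublinear_add[OF L(1), of "- x" "- y"] neg[of "x + y"] neg
      by (simp add: algebra_simps)
    show "L (t *\<^sub>R x) = t *\<^sub>R L x" for t x
      using sublinear_scale[OF L(1), of t x] sublinear_scale[OF L(1), of "- t" "- x"] neg
      by (cases "0 \<le> t") auto
  qed
  then show thesis using that L by (auto simp: le_fun_def)
qed

lemma sandwich_functional:
  fixes E :: "('a::real_normed_vector \<times> real) set"
  assumes conv: "convex E" and c: "0 \<le> c" and ge: "\<And>h s. (h, s) \<in> E \<Longrightarrow> - c * norm h \<le> s"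
  obtains p :: "'a \<Rightarrow>\<^sub>L real" where "norm p \<le> c" "\<And>h s. (h, s) \<in> E \<Longrightarrow> blinfun_apply p h \<le> s"
proof (cases "E = {}")
  case True
  then show thesis using that[of 0] c by simp
next
  case False
  define T where "T = {0::real..} \<times> E"
  define g where "g = (\<lambda>z::'a. \<lambda>(t::real, h, s). t * s + c * norm (z - t *\<^sub>R h))"
  define P where "P = (\<lambda>z. INF w\<in>T. g z w)"
  have Tne: "T \<noteq> {}" using False by (auto simp: T_def)
  have low: "- c * norm z \<le> g z w" if "w \<in> T" for z w
  proof -
    obtain t h s where w: "w = (t, h, s)" "0 \<le> t" "(h, s) \<in> E" using \<open>w \<in> T\<close> by (auto simp: T_def)
    have "norm (t *\<^sub>R h) \<le> norm z + norm (z - t *\<^sub>R h)"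
      by (metis norm_minus_commute norm_triangle_sub)
    then have "c * (t * norm h) \<le> c * (norm z + norm (z - t *\<^sub>R h))"
      using c w by (intro mult_left_mono) auto
    moreover have "t * (- c * norm h) \<le> t * s" using w ge by (intro mult_left_mono) auto
    ultimately show ?thesis by (simp add: g_def w algebra_simps)
  qed
  have bdd: "bdd_below (g z ` T)" for z using low by (intro bdd_belowI2) auto
  have le: "P z \<le> g z w" if "w \<in> T" for z w unfolding P_def by (rule cINF_lower[OF bdd that])
  have ex: "\<exists>w\<in>T. g z w < r" if "P z < r" for z r
    using that Tne unfolding P_def by (subst (asm) cINF_less_iff) (auto simp: bdd)
  have Pc: "P z \<le> c * norm z" for z
  proof -
    obtain h s where "(h, s) \<in> E" using False by auto
    then show ?thesis using le[of "(0, h, s)" z] by (simp add: T_def g_def)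
  qed
  have "sublinear P"
    unfolding sublinear_def
  proof (intro conjI allI impI)
    fix y z
    show "P (y + z) \<le> P y + P z"
    proof (rule field_le_epsilon)
      fix e :: real assume "e > 0"
      obtain v w where v: "v \<in> T" "g y v < P y + e / 2" and w: "w \<in> T" "g z w < P z + e / 2"
        using ex[of y "P y + e / 2"] ex[of z "P z + e / 2"] \<open>e > 0\<close> by auto
      obtain t h s where v': "v = (t, h, s)" "0 \<le> t" "(h, s) \<in> E" using v by (auto simp: T_def)
      obtain t' h' s' where w': "w = (t', h', s')" "0 \<le> t'" "(h', s') \<in> E" using w by (auto simp: T_def)
      have "\<exists>u\<in>T. g (y + z) u \<le> g y v + g z w"
      proof (cases "t + t' = 0")
        case True
        then have "t = 0" "t' = 0" using v' w' by auto
        then show ?thesis using v v' w' c norm_triangle_ineq[of y z]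
          by (intro bexI[of _ v]) (auto simp: g_def distrib_left[symmetric] intro: mult_left_mono)
      next
        case False
        then have tt: "t + t' > 0" using v' w' by linarith
        define h'' where "h'' = (t / (t + t')) *\<^sub>R h + (t' / (t + t')) *\<^sub>R h'"
        define s'' where "s'' = (t / (t + t')) * s + (t' / (t + t')) * s'"
        have "(t / (t + t')) *\<^sub>R (h, s) + (t' / (t + t')) *\<^sub>R (h', s') \<in> E"
          using tt v' w' by (intro convexD[OF conv]) (auto simp: add_divide_distrib[symmetric])
        then have E: "(h'', s'') \<in> E" by (simp add: h''_def s''_def)
        have hh: "(t + t') *\<^sub>R h'' = t *\<^sub>R h + t' *\<^sub>R h'" using tt by (simp add: h''_def scaleR_add_right)
        have ss: "(t + t') * s'' = t * s + t' * s'"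
          using tt by (simp add: s''_def distrib_left)
        have "norm (y + z - (t + t') *\<^sub>R h'') \<le> norm (y - t *\<^sub>R h) + norm (z - t' *\<^sub>R h')"
          unfolding hh by (metis add_diff_add norm_triangle_ineq)
        then have "c * norm (y + z - (t + t') *\<^sub>R h'') \<le> c * (norm (y - t *\<^sub>R h) + norm (z - t' *\<^sub>R h'))"
          using c by (rule mult_left_mono)
        then have "g (y + z) (t + t', h'', s'') \<le> g y v + g z w"
          using ss unfolding g_def v' w' by (simp add: distrib_left)
        then show ?thesis using E v' w' by (intro bexI) (auto simp: T_def)
      qed
      then show "P (y + z) \<le> P y + P z + e" using le v w by (smt (verit) field_sum_of_halves)
    qed
  next
    fix a :: real and z :: 'a assume a: "0 \<le> a"
    have le1: "P (a *\<^sub>R z) \<le> a * P z" if a: "0 < a" for a z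
    proof -
      have "P (a *\<^sub>R z) / a \<le> g z w" if w: "w \<in> T" for w
      proof -
        obtain t h s where w': "w = (t, h, s)" "0 \<le> t" "(h, s) \<in> E" using w by (auto simp: T_def)
        have "P (a *\<^sub>R z) \<le> g (a *\<^sub>R z) (a * t, h, s)" using w' a by (intro le) (auto simp: T_def)
        also have "norm (a *\<^sub>R z - (a * t) *\<^sub>R h) = a * norm (z - t *\<^sub>R h)"
          using norm_scaleR[of a "z - t *\<^sub>R h"] a by (simp add: scaleR_diff_right)
        then have "g (a *\<^sub>R z) (a * t, h, s) = a * g z w" by (simp add: g_def w' distrib_left)
        finally show ?thesis using a by (simp add: field_simps)
      qed
      then have "P (a *\<^sub>R z) / a \<le> P z" unfolding P_def using Tne by (intro cINF_greatest) auto
      then show ?thesis using a by (simp add: field_simps)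
    qed
    show "P (a *\<^sub>R z) = a * P z"
    proof (cases "a = 0")
      case True
      have "0 \<le> P 0" unfolding P_def using low[of _ 0] Tne by (intro cINF_greatest) auto
      then show ?thesis using True Pc[of 0] by simp
    next
      case False
      with a have a: "0 < a" by simp
      have "P z \<le> 1 / a * P (a *\<^sub>R z)" using le1[of "1 / a" "a *\<^sub>R z"] a by simp
      then show ?thesis using le1[OF a, of z] a by (simp add: field_simps)
    qed
  qed
  then obtain L where L: "linear L" "\<And>x. L x \<le> P x" by (rule Hahn_Banach_sublinear) (rule that)
  have Lc: "\<bar>L x\<bar> \<le> c * norm x" for x
    using L(2)[of x] L(2)[of "- x"] Pc[of x] Pc[of "- x"] linear_neg[OF L(1), of x] by simp
  have bl: "bounded_linear L"
    using L(1) Lc by (intro bounded_linear_intro[of _ c]) (auto simp: linear_add linear_scale mult.commute)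
  show thesis
  proof (rule that[of "Blinfun L"])
    show "norm (Blinfun L) \<le> c"
      using Lc c bl by (intro norm_blinfun_bound) (auto simp: bounded_linear_Blinfun_apply)
    fix h s assume "(h, s) \<in> E"
    then have "P h \<le> g h (1, h, s)" by (intro le) (auto simp: T_def)
    then show "Blinfun L h \<le> s" using L(2)[of h] bl by (simp add: g_def bounded_linear_Blinfun_apply)
  qed
qed

lemma blinfun_apply_le_norm:
  fixes p :: "'a::real_normed_vector \<Rightarrow>\<^sub>L real"
  assumes "norm p \<le> 1"
  shows "\<bar>blinfun_apply p x\<bar> \<le> norm x"
  using norm_blinfun[of p x] mult_right_mono[OF assms norm_ge_zero[of x]] by simp

lemma exists_norming_functional:
  fixes x :: "'a::real_normed_vector"
  obtains p :: "'a \<Rightarrow>\<^sub>L real" where "norm p \<le> 1" "blinfun_apply p x = norm x"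
proof -
  obtain p :: "'a \<Rightarrow>\<^sub>L real" where p: "norm p \<le> 1" "blinfun_apply p (- x) \<le> - norm x"
    using sandwich_functional[of "{(- x, - norm x)}" 1] by auto
  have "\<bar>blinfun_apply p x\<bar> \<le> norm x" using p(1) by (rule blinfun_apply_le_norm)
  then show thesis using that p by (simp add: blinfun.minus_right)
qed

lemma extend_functional:
  fixes Y :: "'a::real_normed_vector set" and L :: "'a \<Rightarrow> real"
  assumes Y: "subspace Y" and c: "0 \<le> c"
    and add: "\<And>x y. x \<in> Y \<Longrightarrow> y \<in> Y \<Longrightarrow> L (x + y) = L x + L y"
    and scale: "\<And>t x. x \<in> Y \<Longrightarrow> L (t *\<^sub>R x) = t * L x"
    and bound: "\<And>x. x \<in> Y \<Longrightarrow> \<bar>L x\<bar> \<le> c * norm x"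
  obtains p :: "'a \<Rightarrow>\<^sub>L real" where "norm p \<le> c" "\<And>x. x \<in> Y \<Longrightarrow> blinfun_apply p x = L x"
proof -
  let ?E = "(\<lambda>x. (x, L x)) ` Y"
  have "convex ?E"
    unfolding convex_def
  proof (intro ballI allI impI)
    fix a b :: "'a \<times> real" and u v :: real assume "a \<in> ?E" "b \<in> ?E"
    then obtain x y where xy: "x \<in> Y" "y \<in> Y" "a = (x, L x)" "b = (y, L y)" by auto
    then have "u *\<^sub>R x + v *\<^sub>R y \<in> Y" using Y by (simp add: subspace_add subspace_scale)
    moreover have "L (u *\<^sub>R x + v *\<^sub>R y) = u * L x + v * L y"
      using xy Y by (simp add: add scale subspace_scale)
    ultimately show "u *\<^sub>R a + v *\<^sub>R b \<in> ?E" using xy by auto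
  qed
  then obtain p :: "'a \<Rightarrow>\<^sub>L real" where p: "norm p \<le> c" "\<And>h s. (h, s) \<in> ?E \<Longrightarrow> blinfun_apply p h \<le> s"
    using sandwich_functional[of ?E c] bound c by (smt (verit) Pair_inject image_iff mult_minus_left)
  have le: "blinfun_apply p x \<le> L x" if "x \<in> Y" for x using p(2) that by auto
  have "blinfun_apply p x = L x" if "x \<in> Y" for x
    using le[OF that] le[of "- x"] scale[OF that, of "- 1"] Y that
    by (simp add: subspace_neg blinfun.minus_right)
  then show thesis using that p by blast
qed

text \<open>A minimal sublinear function dominating \<open>A\<close> on \<open>Y\<close> inherits the absence of small slices
  of \<open>A\<close> over \<open>Y\<close>, hence would be nowhere Frechet differentiable on the whole space.\<close>

lemma asplund_small_slice:
  fixes A :: "('a::real_normed_vector \<Rightarrow>\<^sub>L real) set"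
  assumes asp: "asplund TYPE('a)" and Y: "subspace Y"
    and A: "A \<noteq> {}" "\<And>a. a \<in> A \<Longrightarrow> norm a \<le> 1" and e: "e > 0"
  shows "\<exists>y\<in>Y. \<exists>\<beta>. (\<exists>a\<in>A. blinfun_apply a y > \<beta>) \<and>
    (\<forall>a\<in>A. \<forall>b\<in>A. blinfun_apply a y > \<beta> \<longrightarrow> blinfun_apply b y > \<beta> \<longrightarrow>
       (\<forall>h\<in>Y. norm h \<le> 1 \<longrightarrow> blinfun_apply a h - blinfun_apply b h \<le> e))"
proof (rule ccontr)
  assume "\<not> ?thesis"
  then have no: "\<exists>a\<in>A. \<exists>b\<in>A. blinfun_apply a y > \<beta> \<and> blinfun_apply b y > \<beta> \<and>
      (\<exists>h\<in>Y. norm h \<le> 1 \<and> e < blinfun_apply a h - blinfun_apply b h)"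
    if "y \<in> Y" "a \<in> A" "blinfun_apply a y > \<beta>" for y a \<beta>
    using that by (meson not_le)
  define q where "q = (\<lambda>y. SUP a\<in>A. blinfun_apply a y)"
  have an: "blinfun_apply a y \<le> norm y" if "a \<in> A" for a y
    using blinfun_apply_le_norm[OF A(2)[OF that], of y] by simp
  have bdd: "bdd_above ((\<lambda>a. blinfun_apply a y) ` A)" for y using an by (intro bdd_aboveI2)
  have qn: "q y \<le> norm y" for y unfolding q_def using A(1) an by (intro cSUP_least) auto
  have aq: "blinfun_apply a y \<le> q y" if "a \<in> A" for a y
    unfolding q_def by (rule cSUP_upper[OF that bdd])
  have qa: "\<exists>a\<in>A. r < blinfun_apply a y" if "r < q y" for y r
    using that A(1) bdd unfolding q_def by (subst (asm) less_cSUP_iff) auto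
  obtain P where P: "sublinear P" "P \<le> norm" "\<And>y. y \<in> Y \<Longrightarrow> q y \<le> P y"
    and min: "\<And>R. sublinear R \<Longrightarrow> R \<le> P \<Longrightarrow> (\<And>y. y \<in> Y \<Longrightarrow> q y \<le> R y) \<Longrightarrow> R = P"
    using minimal_sublinear[OF sublinear_norm, of Y q] qn by metis
  have lip: "\<bar>P x - P y\<bar> \<le> norm (x - y)" for x y
    using sublinear_diff[OF P(1), of x y] sublinear_diff[OF P(1), of y x] P(2)
    by (smt (verit) le_fun_def norm_minus_commute)
  have "continuous_on UNIV P"
    by (rule lipschitz_on_continuous_on[of 1]) (auto intro!: lipschitz_onI simp: dist_norm lip)
  moreover have "convex_on UNIV P"
    using sublinear_add[OF P(1)] sublinear_scale[OF P(1)]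
    by (intro convex_onI) (metis (no_types, opaque_lifting) diff_ge_0_iff_ge less_eq_real_def, simp)
  ultimately obtain D where D: "UNIV \<subseteq> closure D" "\<forall>x\<in>D. P differentiable (at x)"
    using asp unfolding asplund_def by (metis convex_UNIV open_UNIV)
  then obtain x where "P differentiable (at x)" by (metis UNIV_not_empty closure_empty ex_in_conv subset_empty)
  then obtain P' where P': "(P has_derivative P') (at x)" by (auto simp: differentiable_def)
  obtain d where d: "d > 0" "\<And>y. norm (y - x) < d \<Longrightarrow> norm (P y - P x - P' (y - x)) \<le> e / 4 * norm (y - x)"
    using has_derivative_within_alt[of P P' x UNIV] P' e by (metis UNIV_I divide_pos_pos zero_less_numeral)
  define t where "t = d / 2"
  have t: "t > 0" "t < d" using d by (auto simp: t_def)
  have lin: "linear P'" using P' by (simp add: has_derivative_bounded_linear bounded_linear.linear)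
  define \<alpha> where "\<alpha> = e * t / 8"
  have \<alpha>: "\<alpha> > 0" using e t by (simp add: \<alpha>_def)
  obtain y s where ys: "y \<in> Y" "s \<ge> 0" "P (y - s *\<^sub>R x) + s * (P x - \<alpha>) < q y"
  proof (cases "0 \<le> P (- x) + (P x - \<alpha>)")
    case True
    define R where "R = (\<lambda>z. INF t\<in>{0..}. P (z - t *\<^sub>R x) + t * (P x - \<alpha>))"
    have R: "sublinear R" "R \<le> P" "R x \<le> P x - \<alpha>"
      "\<And>z r. R z < r \<Longrightarrow> \<exists>t\<ge>0. P (z - t *\<^sub>R x) + t * (P x - \<alpha>) < r"
      using sublinear_cut[OF P(1) True] by (simp_all add: R_def)
    have "R \<noteq> P" using R(3) \<alpha> by auto
    then obtain y where "y \<in> Y" "R y < q y" using min[OF R(1,2)] by (metis not_le)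
    then show thesis using R(4)[of y "q y"] that by blast
  next
    case False
    obtain a where "a \<in> A" using A by auto
    then have "0 \<le> q 0" using aq[of a 0] by simp
    then show thesis using that[of 0 1] False subspace_0[OF Y] by simp
  qed
  have s: "s > 0" using ys P(3)[OF ys(1)] by (cases "s = 0") auto
  define \<beta> where "\<beta> = P (y - s *\<^sub>R x) + s * (P x - \<alpha>)"
  obtain a where "a \<in> A" "\<beta> < blinfun_apply a y" using qa ys(3) unfolding \<beta>_def by blast
  from no[OF ys(1) this] obtain a b h where ab: "a \<in> A" "b \<in> A" "\<beta> < blinfun_apply a y" "\<beta> < blinfun_apply b y"
    and h: "h \<in> Y" "norm h \<le> 1" "e < blinfun_apply a h - blinfun_apply b h" by blast
  have key: "blinfun_apply c y + s * blinfun_apply c v \<le> s * P (x + v) + P (y - s *\<^sub>R x)"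
    if "c \<in> A" "v \<in> Y" for c v
  proof -
    have "blinfun_apply c y + s * blinfun_apply c v = blinfun_apply c (y + s *\<^sub>R v)"
      by (simp add: blinfun.add_right blinfun.scaleR_right)
    also have "\<dots> \<le> P (y + s *\<^sub>R v)"
      using aq[OF that(1)] P(3)[of "y + s *\<^sub>R v"] ys(1) that(2) Y
      by (meson order_trans subspace_add subspace_scale)
    also have "y + s *\<^sub>R v = s *\<^sub>R (x + v) + (y - s *\<^sub>R x)" by (simp add: algebra_simps)
    also have "P (s *\<^sub>R (x + v) + (y - s *\<^sub>R x)) \<le> s * P (x + v) + P (y - s *\<^sub>R x)"
      using sublinear_add[OF P(1)] sublinear_scale[OF P(1), of s] s by (metis less_imp_le)
    finally show ?thesis .
  qed
  have tY: "t *\<^sub>R h \<in> Y" "- (t *\<^sub>R h) \<in> Y" using h Y by (simp_all add: subspace_scale subspace_neg)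
  have "s * (t * e) < s * (t * (blinfun_apply a h - blinfun_apply b h))" using s t h by simp
  moreover have "blinfun_apply b (- (t *\<^sub>R h)) = - t * blinfun_apply b h"
    by (simp add: blinfun.minus_right blinfun.scaleR_right)
  moreover have "blinfun_apply a (t *\<^sub>R h) = t * blinfun_apply a h"
    by (simp add: blinfun.scaleR_right)
  ultimately have "s * (t * e) + 2 * (s * (P x - \<alpha>)) < s * P (x + t *\<^sub>R h) + s * P (x + - (t *\<^sub>R h))"
    using key[OF ab(1) tY(1)] key[OF ab(2) tY(2)] ab(3,4) unfolding \<beta>_def by (simp add: algebra_simps)
  then have "s * (t * e + 2 * (P x - \<alpha>)) < s * (P (x + t *\<^sub>R h) + P (x + - (t *\<^sub>R h)))"
    by (simp add: algebra_simps)
  then have 1: "t * e + 2 * (P x - \<alpha>) < P (x + t *\<^sub>R h) + P (x + - (t *\<^sub>R h))" using s by simp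
  have th: "norm (t *\<^sub>R h) \<le> t" using t h by (simp add: mult_left_le)
  have P'n: "P' (- (t *\<^sub>R h)) = - P' (t *\<^sub>R h)" by (rule linear_neg[OF lin])
  have "norm (P (x + t *\<^sub>R h) - P x - P' (t *\<^sub>R h)) \<le> e / 4 * norm (t *\<^sub>R h)"
    using d(2)[of "x + t *\<^sub>R h"] le_less_trans[OF th t(2)] by (simp del: norm_scaleR)
  moreover have "norm (P (x + - (t *\<^sub>R h)) - P x - P' (- (t *\<^sub>R h))) \<le> e / 4 * norm (t *\<^sub>R h)"
    using d(2)[of "x + - (t *\<^sub>R h)"] le_less_trans[OF th t(2)] by (simp del: norm_scaleR)
  moreover have "e / 4 * norm (t *\<^sub>R h) \<le> e / 4 * t" using th e by (intro mult_left_mono) auto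
  ultimately have "P (x + t *\<^sub>R h) + P (x + - (t *\<^sub>R h)) \<le> 2 * P x + 2 * (e / 4 * t)"
    unfolding P'n real_norm_def by linarith
  with 1 have "t * e < 2 * \<alpha> + 2 * (e / 4 * t)" by simp
  moreover have "2 * \<alpha> + 2 * (e / 4 * t) = 3 / 4 * (t * e)" by (simp add: \<alpha>_def)
  moreover have "t * e > 0" using t e by simp
  ultimately show False by linarith
qed

section \<open>The variational principle\<close>

theorem perturbed_minimum:
  fixes f :: "'a::banach \<Rightarrow> real" and \<phi> :: "nat \<Rightarrow> 'a \<Rightarrow> real" and \<mu> s :: "nat \<Rightarrow> real"
  assumes x0: "x0 \<in> D" and nonneg: "\<forall>x\<in>D. 0 \<le> f x"
    and closed: "\<And>r. closed {x \<in> D. f x \<le> r}"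
    and \<mu>: "\<And>n. 0 < \<mu> n" "summable \<mu>" and s: "\<And>n. 0 \<le> s n" "summable s"
    and lip: "\<And>n u v. \<bar>\<phi> n u - \<phi> n v\<bar> \<le> norm (u - v)" and zero: "\<And>n. \<phi> n 0 = 0"
    and low: "\<And>n z. norm z - s n \<le> \<phi> n z"
  shows "\<exists>X x. X 0 = x0 \<and> (\<forall>n. X n \<in> D) \<and> x \<in> D \<and> (\<forall>y. summable (\<lambda>n. \<mu> n * \<phi> n (y - X n))) \<and>
    (\<forall>y\<in>D. f x + (\<Sum>n. \<mu> n * \<phi> n (x - X n)) \<le> f y + (\<Sum>n. \<mu> n * \<phi> n (y - X n)))"
proof -
  define \<eta> where "\<eta> n = \<mu> (Suc n) * (1 / 2) ^ n" for n
  have \<eta>: "\<eta> n > 0" for n using \<mu> by (simp add: \<eta>_def)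
  define P :: "nat \<Rightarrow> ('a \<Rightarrow> real) \<times> 'a \<Rightarrow> bool" where
    "P n S \<longleftrightarrow> snd S \<in> D \<and> bdd_below (fst S ` D) \<and> (n = 0 \<longrightarrow> S = (f, x0))" for n S
  define Q :: "nat \<Rightarrow> ('a \<Rightarrow> real) \<times> 'a \<Rightarrow> ('a \<Rightarrow> real) \<times> 'a \<Rightarrow> bool" where
    "Q n S T \<longleftrightarrow> fst T = (\<lambda>y. fst S y + \<mu> n * \<phi> n (y - snd S)) \<and>
      fst T (snd T) \<le> fst T (snd S) \<and> (\<forall>y\<in>D. fst T (snd T) \<le> fst T y + \<eta> n)" for n S T
  have "\<exists>S. \<forall>n. P n (S n) \<and> Q n (S n) (S (Suc n))"
  proof (rule dependent_nat_choice)
    show "\<exists>S. P 0 S" using x0 bdd_belowI2[of D 0 f] nonneg by (intro exI[of _ "(f, x0)"]) (auto simp: P_def)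
    fix S n assume "P n S"
    then have S: "snd S \<in> D" "bdd_below (fst S ` D)" by (auto simp: P_def)
    define g where "g = (\<lambda>y. fst S y + \<mu> n * \<phi> n (y - snd S))"
    obtain m where m: "\<And>y. y \<in> D \<Longrightarrow> m \<le> fst S y" using S(2) by (auto simp: bdd_below_def)
    have "- s n \<le> \<phi> n z" for z using low[of z n] norm_ge_zero[of z] by linarith
    then have "m - \<mu> n * s n \<le> g y" if "y \<in> D" for y
      using m[OF that] mult_left_mono[of "- s n" "\<phi> n (y - snd S)" "\<mu> n"] \<mu>(1)[of n]
      unfolding g_def by fastforce
    then have bdd: "bdd_below (g ` D)" by (intro bdd_belowI2)
    have "\<exists>x\<in>D. g x \<le> g (snd S) \<and> (\<forall>y\<in>D. g x \<le> g y + \<eta> n)"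
    proof -
      obtain x where x: "x \<in> D" "g x < (INF y\<in>D. g y) + \<eta> n"
        using cINF_less_iff[of D g "(INF y\<in>D. g y) + \<eta> n"] bdd S(1) \<eta>[of n] by auto
      have I: "(INF y\<in>D. g y) \<le> g y" if "y \<in> D" for y by (rule cINF_lower[OF bdd that])
      show ?thesis
      proof (cases "g x \<le> g (snd S)")
        case True
        then show ?thesis using x I by (intro bexI[of _ x]) fastforce+
      next
        case False
        then show ?thesis using x I S(1) by (intro bexI[of _ "snd S"]) fastforce+
      qed
    qed
    then obtain x where "x \<in> D" "g x \<le> g (snd S)" "\<forall>y\<in>D. g x \<le> g y + \<eta> n" by blast
    then show "\<exists>T. P (Suc n) T \<and> Q n S T"
      using bdd by (intro exI[of _ "(g, x)"]) (auto simp: P_def Q_def g_def)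
  qed
  then obtain S where PQ: "\<And>n. P n (S n)" "\<And>n. Q n (S n) (S (Suc n))" by blast
  define X where "X n = snd (S n)" for n
  define g where "g n = fst (S n)" for n
  have X0: "X 0 = x0" and g0: "g 0 = f" and XD: "X n \<in> D" for n
    using PQ(1)[of 0] PQ(1)[of n] by (auto simp: P_def X_def g_def)
  note QS = PQ(2)[unfolded Q_def, folded g_def X_def]
  have gS: "g (Suc n) y = g n y + \<mu> n * \<phi> n (y - X n)" for n y
    by (rule fun_cong[OF conjunct1[OF QS]])
  have gX: "g (Suc n) (X (Suc n)) \<le> g (Suc n) (X n)" for n
    by (rule conjunct1[OF conjunct2[OF QS]])
  have gmin: "g (Suc n) (X (Suc n)) \<le> g (Suc n) y + \<eta> n" if "y \<in> D" for n y
    by (rule bspec[OF conjunct2[OF conjunct2[OF QS]] that])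
  have g: "g n y = f y + (\<Sum>k<n. \<mu> k * \<phi> k (y - X k))" for n y
    by (induction n) (auto simp: g0 gS)
  have step: "norm (X (Suc (Suc n)) - X (Suc n)) \<le> (1 / 2) ^ n + s (Suc n)" for n
  proof -
    let ?v = "X (Suc (Suc n)) - X (Suc n)"
    have "\<mu> (Suc n) * \<phi> (Suc n) ?v \<le> \<eta> n"
      using gX[of "Suc n"] gmin[OF XD[of "Suc (Suc n)"], of n] by (simp add: gS[of "Suc n"] zero)
    then have "\<mu> (Suc n) * \<phi> (Suc n) ?v \<le> \<mu> (Suc n) * (1 / 2) ^ n" by (simp add: \<eta>_def)
    then have "\<phi> (Suc n) ?v \<le> (1 / 2) ^ n" using \<mu>(1)[of "Suc n"] by (simp only: mult_le_cancel_left_pos)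
    then show ?thesis using low[of ?v "Suc n"] by linarith
  qed
  have "summable (\<lambda>n. X (Suc (Suc n)) - X (Suc n))"
  proof (rule summable_norm_cancel, rule summable_comparison_test')
    show "summable (\<lambda>n. (1 / 2) ^ n + s (Suc n))"
      using s(2) by (intro summable_add summable_geometric) (auto simp: summable_Suc_iff)
    show "norm (norm (X (Suc (Suc n)) - X (Suc n))) \<le> (1 / 2) ^ n + s (Suc n)" for n using step by simp
  qed
  then have "summable (\<lambda>n. X (Suc n) - X n)" by (subst (asm) summable_Suc_iff)
  then have "convergent (\<lambda>n. \<Sum>k<n. X (Suc k) - X k)" by (simp add: summable_iff_convergent)
  then have "convergent (\<lambda>n. X n - X 0)" by (simp add: sum_lessThan_telescope)
  then have "convergent (\<lambda>n. (X n - X 0) + X 0)" by (intro convergent_add convergent_const)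
  then obtain x where x: "X \<longlonglongrightarrow> x" by (auto simp: convergent_def)
  obtain M where M: "\<And>n. norm (X n) \<le> M"
    using x by (meson Bseq_def convergentI convergent_imp_Bseq)
  have bound: "\<bar>\<mu> k * \<phi> k (y - X k)\<bar> \<le> \<mu> k * (norm y + M)" for k y
  proof -
    have "\<bar>\<phi> k (y - X k)\<bar> \<le> norm y + M"
      using lip[of k "y - X k" 0] zero[of k] M[of k] norm_triangle_ineq4[of y "X k"] by simp
    then show ?thesis using \<mu>(1)[of k] by (simp add: abs_mult)
  qed
  have summ: "summable (\<lambda>n. \<mu> n * \<phi> n (y - X n))" for y
    using bound by (intro summable_comparison_test'[OF summable_mult2[OF \<mu>(2)]]) auto
  define q where "q y = (\<Sum>n. \<mu> n * \<phi> n (y - X n))" for y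
  have qlim: "(\<lambda>n. \<Sum>k<n. \<mu> k * \<phi> k (y - X k)) \<longlonglongrightarrow> q y" for y
    unfolding q_def by (rule summable_LIMSEQ[OF summ])
  have qX: "(\<lambda>n. \<Sum>k<n. \<mu> k * \<phi> k (X n - X k)) \<longlonglongrightarrow> q x"
  proof -
    have le: "\<bar>(\<Sum>k<n. \<mu> k * \<phi> k (X n - X k)) - (\<Sum>k<n. \<mu> k * \<phi> k (x - X k))\<bar> \<le> suminf \<mu> * norm (X n - x)" for n
    proof -
      have "\<bar>(\<Sum>k<n. \<mu> k * \<phi> k (X n - X k)) - (\<Sum>k<n. \<mu> k * \<phi> k (x - X k))\<bar>
        = \<bar>\<Sum>k<n. \<mu> k * (\<phi> k (X n - X k) - \<phi> k (x - X k))\<bar>"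
        by (simp add: sum_subtractf right_diff_distrib)
      also have "\<dots> \<le> (\<Sum>k<n. \<mu> k * norm (X n - x))"
      proof (rule order_trans[OF sum_abs sum_mono])
        fix k
        show "\<bar>\<mu> k * (\<phi> k (X n - X k) - \<phi> k (x - X k))\<bar> \<le> \<mu> k * norm (X n - x)"
          using lip[of k "X n - X k" "x - X k"] \<mu>(1)[of k] by (simp add: abs_mult)
      qed
      also have "\<dots> = (\<Sum>k<n. \<mu> k) * norm (X n - x)" by (simp add: sum_distrib_right)
      also have "\<dots> \<le> suminf \<mu> * norm (X n - x)"
        using sum_le_suminf[OF \<mu>(2), of "{..<n}"] \<mu>(1) by (intro mult_right_mono) (auto simp: less_imp_le)
      finally show ?thesis .
    qed
    have lim0: "(\<lambda>n. suminf \<mu> * norm (X n - x)) \<longlonglongrightarrow> 0"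
      using x by (intro tendsto_mult_right_zero tendsto_norm_zero) (simp add: LIM_zero)
    have "(\<lambda>n. (\<Sum>k<n. \<mu> k * \<phi> k (X n - X k)) - (\<Sum>k<n. \<mu> k * \<phi> k (x - X k))) \<longlonglongrightarrow> 0"
      by (rule Lim_null_comparison[OF always_eventually[OF allI] lim0]) (simp only: real_norm_def le)
    then show ?thesis by (rule Lim_transform[OF qlim[of x]])
  qed
  have "\<eta> \<longlonglongrightarrow> 0"
  proof -
    have "(\<lambda>n. \<mu> (Suc n)) \<longlonglongrightarrow> 0" by (rule LIMSEQ_Suc[OF summable_LIMSEQ_zero[OF \<mu>(2)]])
    moreover have "(\<lambda>n. (1 / 2 :: real) ^ n) \<longlonglongrightarrow> 0" by (rule LIMSEQ_power_zero) simp
    ultimately show ?thesis unfolding \<eta>_def by (rule tendsto_mult_zero)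
  qed
  have main: "x \<in> D \<and> f x \<le> f y + q y - q x + e" if y: "y \<in> D" and e: "e > 0" for y e
  proof -
    define b where "b n = f y + (\<Sum>k<Suc n. \<mu> k * \<phi> k (y - X k))
      - (\<Sum>k<Suc n. \<mu> k * \<phi> k (X (Suc n) - X k)) + \<eta> n" for n
    have "b \<longlonglongrightarrow> f y + q y - q x + 0"
      unfolding b_def
      by (intro tendsto_intros LIMSEQ_Suc[OF qlim] LIMSEQ_Suc[OF qX] \<open>\<eta> \<longlonglongrightarrow> 0\<close>)
    then have "eventually (\<lambda>n. b n < f y + q y - q x + e) sequentially"
      using e by (intro order_tendstoD(2)) auto
    then obtain N where N: "\<And>n. n \<ge> N \<Longrightarrow> b n < f y + q y - q x + e"
      by (auto simp: eventually_sequentially)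
    have "f (X (Suc n)) \<le> b n" for n
      using gmin[OF y, of n] unfolding g b_def by linarith
    then have "f (X (Suc (n + N))) \<le> f y + q y - q x + e" for n using N[of "n + N"] by (smt (verit) le_add2)
    moreover have "(\<lambda>n. X (Suc (n + N))) \<longlonglongrightarrow> x" using LIMSEQ_ignore_initial_segment[OF LIMSEQ_Suc[OF x], of N] by simp
    ultimately show ?thesis
      using closed_sequentially[OF closed, of "\<lambda>n. X (Suc (n + N))" "f y + q y - q x + e" x] XD by simp
  qed
  show ?thesis
  proof (intro exI[of _ X] exI[of _ x] conjI allI ballI X0 XD summ)
    show "x \<in> D" using main[OF x0, of 1] by simp
    fix y assume y: "y \<in> D"
    have "f x \<le> f y + q y - q x" by (rule field_le_epsilon) (use main[OF y] in auto)
    then show "f x + (\<Sum>n. \<mu> n * \<phi> n (x - X n)) \<le> f y + (\<Sum>n. \<mu> n * \<phi> n (y - X n))"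
      by (simp add: q_def)
  qed
qed

section \<open>Separability of duals of separable subspaces of Asplund spaces\<close>

lemma separable_if_separated_countable:
  fixes S :: "'b::metric_space set"
  assumes "\<And>e A. e > 0 \<Longrightarrow> A \<subseteq> S \<Longrightarrow> (\<And>a b. a \<in> A \<Longrightarrow> b \<in> A \<Longrightarrow> a \<noteq> b \<Longrightarrow> e \<le> dist a b) \<Longrightarrow> countable A"
  obtains D where "countable D" "D \<subseteq> S" "S \<subseteq> closure D"
proof -
  define \<A> where "\<A> e = {A. A \<subseteq> S \<and> (\<forall>a\<in>A. \<forall>b\<in>A. a \<noteq> b \<longrightarrow> e \<le> dist a b)}" for e :: real
  have "\<exists>M\<in>\<A> e. \<forall>A\<in>\<A> e. M \<subseteq> A \<longrightarrow> A = M" for e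
  proof (rule subset_Zorn')
    fix C assume "subset.chain (\<A> e) C"
    then have C: "C \<subseteq> \<A> e" "\<And>X Y. X \<in> C \<Longrightarrow> Y \<in> C \<Longrightarrow> X \<subseteq> Y \<or> Y \<subseteq> X"
      by (auto simp: subset_chain_def)
    have "e \<le> dist a b" if "a \<in> \<Union>C" "b \<in> \<Union>C" "a \<noteq> b" for a b
    proof -
      obtain X where "X \<in> C" "a \<in> X" "b \<in> X" 
        using \<open>a \<in> \<Union>C\<close> \<open>b \<in> \<Union>C\<close> C(2) by (metis UnionE subsetD)
      then show ?thesis using C(1) that by (auto simp: \<A>_def)
    qed
    then show "\<Union>C \<in> \<A> e" using C(1) by (auto simp: \<A>_def)
  qed
  then obtain M where M: "\<And>e. M e \<in> \<A> e" "\<And>e A. A \<in> \<A> e \<Longrightarrow> M e \<subseteq> A \<Longrightarrow> A = M e" by metis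
  define D where "D = (\<Union>n. M (1 / real (Suc n)))"
  show thesis
  proof (rule that[of D])
    show "countable D" unfolding D_def using M(1)
      by (intro countable_UN assms[of "1 / real (Suc _)"]) (auto simp: \<A>_def simp del: of_nat_Suc)
    show "D \<subseteq> S" using M(1) by (auto simp: D_def \<A>_def)
    show "S \<subseteq> closure D"
    proof
      fix x assume x: "x \<in> S"
      show "x \<in> closure D"
        unfolding closure_approachable
      proof (intro allI impI)
        fix e :: real assume "e > 0"
        then obtain n where n: "1 / real (Suc n) < e" using nat_approx_posE by blast
        let ?e = "1 / real (Suc n)"
        have "\<exists>y\<in>M ?e. dist y x < ?e"
        proof (rule ccontr)
          assume "\<not> ?thesis"
          then have far: "\<And>y. y \<in> M ?e \<Longrightarrow> ?e \<le> dist y x" by (meson not_le)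
          then have "insert x (M ?e) \<in> \<A> ?e" using x M(1)[of ?e] by (auto simp: \<A>_def dist_commute)
          then have "x \<in> M ?e" using M(2) by blast
          then show False using far[of x] by (simp del: of_nat_Suc)
        qed
        then show "\<exists>y\<in>D. dist y x < e" using n unfolding D_def by (meson UN_I UNIV_I less_trans)
      qed
    qed
  qed
qed

lemma infdist_compact_attained:
  fixes C :: "'b::metric_space set"
  assumes "compact C" "C \<noteq> {}"
  obtains c where "c \<in> C" "infdist a C = dist a c"
proof -
  obtain c where c: "c \<in> C" "\<And>y. y \<in> C \<Longrightarrow> dist a c \<le> dist a y"
    using continuous_attains_inf[OF assms continuous_on_dist[OF continuous_on_const continuous_on_id]] by metis
  have "infdist a C = dist a c"
    using c assms(2) infdist_le[OF c(1), of a] by (intro antisym) (auto simp: infdist_def intro!: cINF_greatest)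
  then show thesis using that c by blast
qed

lemma infdist_midpoint:
  fixes C :: "'b::real_normed_vector set"
  assumes C: "compact C" "C \<noteq> {}" "convex C"
  shows "infdist ((1 / 2) *\<^sub>R (a + b)) C \<le> (infdist a C + infdist b C) / 2"
proof -
  obtain c d where c: "c \<in> C" "infdist a C = dist a c" and d: "d \<in> C" "infdist b C = dist b d"
    using infdist_compact_attained[OF C(1,2)] by metis
  have "(1 / 2) *\<^sub>R c + (1 / 2) *\<^sub>R d \<in> C" using C(3) c d by (intro convexD) auto
  then have "infdist ((1 / 2) *\<^sub>R (a + b)) C \<le> dist ((1 / 2) *\<^sub>R (a + b)) ((1 / 2) *\<^sub>R c + (1 / 2) *\<^sub>R d)"
    by (rule infdist_le)
  also have "\<dots> = norm ((1 / 2) *\<^sub>R ((a - c) + (b - d)))" by (simp add: dist_norm algebra_simps)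
  also have "\<dots> \<le> (norm (a - c) + norm (b - d)) / 2"
    using norm_triangle_ineq[of "a - c" "b - d"] by (simp only: norm_scaleR) simp
  finally show ?thesis using c d by (simp add: dist_norm)
qed

lemma pointwise_limit_near_compact:
  fixes a :: "nat \<Rightarrow> ('b::topological_space \<Rightarrow>\<^sub>C 'c::metric_space)"
  assumes lim: "\<And>k. (\<lambda>n. apply_bcontfun (a n) k) \<longlonglongrightarrow> apply_bcontfun l k"
    and C: "compact C" "C \<noteq> {}" and r: "\<And>n. infdist (a n) C \<le> r"
  shows "infdist l C \<le> r" "e > 0 \<Longrightarrow> \<exists>n. dist (a n) l \<le> 2 * r + e"
proof -
  have "\<exists>c. c \<in> C \<and> infdist (a n) C = dist (a n) c" for n
    using infdist_compact_attained[OF C] by metis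
  then obtain c where c: "\<And>n. c n \<in> C" "\<And>n. infdist (a n) C = dist (a n) (c n)" by metis
  then obtain c' \<sigma> where c': "c' \<in> C" "strict_mono (\<sigma> :: nat \<Rightarrow> nat)" "(c \<circ> \<sigma>) \<longlonglongrightarrow> c'"
    using C(1) unfolding compact_def by metis
  have lc: "dist l c' \<le> r"
  proof (rule dist_bound)
    fix k
    have 1: "(\<lambda>n. apply_bcontfun (a (\<sigma> n)) k) \<longlonglongrightarrow> apply_bcontfun l k"
      using LIMSEQ_subseq_LIMSEQ[OF lim c'(2)] by (simp add: o_def)
    have 2: "(\<lambda>n. apply_bcontfun (c (\<sigma> n)) k) \<longlonglongrightarrow> apply_bcontfun c' k"
    proof (rule metric_tendsto_imp_tendsto[OF c'(3)])
      show "eventually (\<lambda>n. dist (apply_bcontfun (c (\<sigma> n)) k) (apply_bcontfun c' k) \<le> dist ((c \<circ> \<sigma>) n) c') sequentially"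
        by (auto simp: dist_bounded)
    qed
    have "(\<lambda>n. dist (apply_bcontfun (a (\<sigma> n)) k) (apply_bcontfun (c (\<sigma> n)) k)) \<longlonglongrightarrow> dist (apply_bcontfun l k) (apply_bcontfun c' k)"
      by (intro tendsto_dist 1 2)
    moreover have "dist (apply_bcontfun (a (\<sigma> n)) k) (apply_bcontfun (c (\<sigma> n)) k) \<le> r" for n
      using dist_bounded[of "a (\<sigma> n)" k "c (\<sigma> n)"] r[of "\<sigma> n"] c(2)[of "\<sigma> n"] by linarith
    ultimately show "dist (apply_bcontfun l k) (apply_bcontfun c' k) \<le> r"
      by (intro LIMSEQ_le_const2) auto
  qed
  then show "infdist l C \<le> r" using infdist_le[OF c'(1), of l] by linarith
  assume "e > 0"
  then obtain n where "dist ((c \<circ> \<sigma>) n) c' < e" using c'(3) by (meson dual_order.refl lim_sequentially)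
  then have "dist (a (\<sigma> n)) l \<le> 2 * r + e"
    using dist_triangle[of "a (\<sigma> n)" l c'] dist_triangle[of "a (\<sigma> n)" c' "c (\<sigma> n)"] lc r[of "\<sigma> n"] c(2)[of "\<sigma> n"]
    by (simp add: dist_commute)
  then show "\<exists>n. dist (a n) l \<le> 2 * r + e" by blast
qed

locale dense_unit_sequence =
  fixes Y :: "'a::real_normed_vector set" and y :: "nat \<Rightarrow> 'a"
  assumes Y: "subspace Y" and yY: "\<And>k. y k \<in> Y" and yn: "\<And>k. norm (y k) \<le> 1"
    and dense: "\<And>h e. h \<in> Y \<Longrightarrow> norm h \<le> 1 \<Longrightarrow> e > 0 \<Longrightarrow> \<exists>k. norm (h - y k) < e"
begin

text \<open>The dual of \<open>Y\<close> is realised isometrically inside the bounded sequences.\<close>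

definition J :: "('a \<Rightarrow>\<^sub>L real) \<Rightarrow> (nat \<Rightarrow>\<^sub>C real)" where
  "J p = Bcontfun (\<lambda>k. blinfun_apply p (y k))"

lemma J_apply: "apply_bcontfun (J p) k = blinfun_apply p (y k)"
proof -
  have "\<bar>blinfun_apply p (y k)\<bar> \<le> norm p" for k
    using norm_blinfun[of p "y k"] mult_left_mono[OF yn[of k] norm_ge_zero[of p]] by simp
  then have "bounded (range (\<lambda>k. blinfun_apply p (y k)))" by (auto simp: bounded_iff)
  then have "(\<lambda>k. blinfun_apply p (y k)) \<in> bcontfun" by (simp add: bcontfun_def)
  then show ?thesis by (simp add: J_def Bcontfun_inverse)
qed

lemma J_add: "J (p + q) = J p + J q" and J_scale: "J (t *\<^sub>R p) = t *\<^sub>R J p"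
  by (rule bcontfun_eqI, simp add: J_apply blinfun.add_left blinfun.scaleR_left)+

lemma apply_diff_le_dist_J:
  assumes "h \<in> Y"
  shows "\<bar>blinfun_apply p h - blinfun_apply q h\<bar> \<le> dist (J p) (J q) * norm h"
proof -
  have 1: "\<bar>blinfun_apply p h - blinfun_apply q h\<bar> \<le> dist (J p) (J q)" if h: "h \<in> Y" "norm h \<le> 1" for h
  proof (rule field_le_epsilon)
    fix e :: real assume e: "e > 0"
    define e' where "e' = e / (norm (p - q) + 1)"
    have n1: "norm (p - q) + 1 > 0" by (smt (verit) norm_ge_zero)
    have e': "e' > 0" using e n1 by (simp add: e'_def)
    obtain k where k: "norm (h - y k) < e'" using dense[OF h e'] by blast
    have "\<bar>blinfun_apply (p - q) (h - y k)\<bar> \<le> norm (p - q) * norm (h - y k)"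
      using norm_blinfun[of "p - q" "h - y k"] by simp
    also have "\<dots> \<le> (norm (p - q) + 1) * e'" using k e' by (intro mult_mono) auto
    also have "\<dots> = e" using n1 by (simp add: e'_def)
    finally have "\<bar>blinfun_apply (p - q) (h - y k)\<bar> \<le> e" .
    moreover have "\<bar>blinfun_apply p (y k) - blinfun_apply q (y k)\<bar> \<le> dist (J p) (J q)"
      using dist_bounded[of "J p" k "J q"] by (simp add: J_apply dist_real_def)
    ultimately show "\<bar>blinfun_apply p h - blinfun_apply q h\<bar> \<le> dist (J p) (J q) + e"
      by (simp add: blinfun.diff_left blinfun.diff_right)
  qed
  show ?thesis
  proof (cases "h = 0")
    case False
    then have n: "norm h > 0" by simp
    define h' where "h' = (1 / norm h) *\<^sub>R h"
    have h': "h' \<in> Y" "norm h' \<le> 1" "h = norm h *\<^sub>R h'"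
      using assms Y n by (auto simp: h'_def subspace_scale)
    have "\<bar>blinfun_apply p h - blinfun_apply q h\<bar> = norm h * \<bar>blinfun_apply p h' - blinfun_apply q h'\<bar>"
      by (subst (1 2) h'(3)) (simp add: blinfun.scaleR_right right_diff_distrib[symmetric] abs_mult)
    also have "\<dots> \<le> norm h * dist (J p) (J q)" using 1[OF h'(1,2)] n by simp
    finally show ?thesis by (simp add: mult.commute)
  qed simp
qed

lemma dual_separable:
  assumes asp: "asplund TYPE('a)"
  shows "\<exists>q :: nat \<Rightarrow> _. (\<forall>n. norm (q n) \<le> 1) \<and> (\<forall>p e. norm p \<le> 1 \<longrightarrow> e > 0 \<longrightarrow> (\<exists>n. dist (J p) (J (q n)) < e))"
proof -
  define B :: "('a \<Rightarrow>\<^sub>L real) set" where "B = cball 0 1"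
  obtain D where D: "countable D" "D \<subseteq> J ` B" "J ` B \<subseteq> closure D"
  proof (rule separable_if_separated_countable[of "J ` B"])
    fix e :: real and A assume e: "e > 0" and AJ: "A \<subseteq> J ` B"
      and sep: "\<And>a b. a \<in> A \<Longrightarrow> b \<in> A \<Longrightarrow> a \<noteq> b \<Longrightarrow> e \<le> dist a b"
    show "countable A"
    proof (rule ccontr)
      assume unc: "uncountable A"
      define A0 where "A0 = inv_into B J ` A"
      have A0: "A0 \<subseteq> B" "J ` A0 = A" using AJ by (auto simp: A0_def inv_into_into image_image f_inv_into_f subset_iff image_iff)
      have uncA0: "uncountable A0" using unc A0(2) by (metis countable_image)
      have sep0: "e \<le> dist (J a) (J b)" if "a \<in> A0" "b \<in> A0" "a \<noteq> b" for a b
      proof -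
        obtain a' b' where "a' \<in> A" "b' \<in> A" "a = inv_into B J a'" "b = inv_into B J b'"
          using \<open>a \<in> A0\<close> \<open>b \<in> A0\<close> by (auto simp: A0_def)
        moreover from this have "J a = a'" "J b = b'" using AJ by (auto simp: f_inv_into_f subset_iff)
        ultimately show ?thesis using sep that by metis
      qed
      define Sl where "Sl = (\<lambda>(k, r :: rat). {a \<in> A0. real_of_rat r < blinfun_apply a (y k)})"
      define Z where "Z = \<Union>{Sl i |i. countable (Sl i)}"
      have "countable Z"
      proof -
        have "{Sl i |i. countable (Sl i)} = Sl ` {i. countable (Sl i)}" by auto
        then show ?thesis unfolding Z_def by (auto intro: countable_UN)
      qed
      then have unc': "uncountable (A0 - Z)" using uncA0 uncountable_minus_countable by blast
      then have "A0 - Z \<noteq> {}" by (metis countable_empty)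
      moreover have "\<And>a. a \<in> A0 - Z \<Longrightarrow> norm a \<le> 1" using A0(1) by (auto simp: B_def)
      ultimately obtain v \<beta> where v: "v \<in> Y" "\<exists>a\<in>A0 - Z. blinfun_apply a v > \<beta>"
        and small: "\<And>a b h. a \<in> A0 - Z \<Longrightarrow> b \<in> A0 - Z \<Longrightarrow> blinfun_apply a v > \<beta> \<Longrightarrow>
          blinfun_apply b v > \<beta> \<Longrightarrow> h \<in> Y \<Longrightarrow> norm h \<le> 1 \<Longrightarrow> blinfun_apply a h - blinfun_apply b h \<le> e / 2"
        using asplund_small_slice[OF asp Y, of "A0 - Z" "e / 2"] e by (smt (verit) half_gt_zero)
      obtain a where a: "a \<in> A0" "a \<notin> Z" "blinfun_apply a v > \<beta>" using v(2) by blast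
      define M where "M = max 1 (norm v)"
      define v' where "v' = (1 / M) *\<^sub>R v"
      have M: "M > 0" "norm v \<le> M" by (auto simp: M_def)
      have v': "v' \<in> Y" "norm v' \<le> 1" "v = M *\<^sub>R v'"
        using v(1) Y M by (auto simp: v'_def subspace_scale)
      have bv: "blinfun_apply b v = M * blinfun_apply b v'" for b
        using v'(3) by (metis blinfun.scaleR_right real_scaleR_def)
      define g where "g = blinfun_apply a v' - \<beta> / M"
      have g: "g > 0" using a(3) M(1) by (simp add: g_def bv field_simps)
      obtain k where k: "norm (v' - y k) < g / 3" using dense[OF v'(1,2), of "g / 3"] g by auto
      obtain r where r: "\<beta> / M + g / 3 < real_of_rat r" "real_of_rat r < \<beta> / M + 2 * (g / 3)"
        using of_rat_dense[of "\<beta> / M + g / 3" "\<beta> / M + 2 * (g / 3)"] g by auto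
      have close: "\<bar>blinfun_apply b v' - blinfun_apply b (y k)\<bar> < g / 3" if "b \<in> A0" for b
        using blinfun_apply_le_norm[of b "v' - y k"] that A0(1) k by (auto simp: B_def blinfun.diff_right)
      have aSl: "a \<in> Sl (k, r)" 
      proof -
        have "blinfun_apply a v' = g + \<beta> / M" by (simp add: g_def)
        then have "real_of_rat r < blinfun_apply a (y k)" using close[OF a(1)] r(2) by linarith
        then show ?thesis using a(1) by (simp add: Sl_def)
      qed
      have inv: "blinfun_apply b v > \<beta>" if "b \<in> Sl (k, r)" for b
      proof -
        have "b \<in> A0" "real_of_rat r < blinfun_apply b (y k)" using that by (auto simp: Sl_def)
        then have "\<beta> / M < blinfun_apply b v'" using close[of b] r(1) by linarith
        then show ?thesis using M(1) by (simp add: bv field_simps)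
      qed
      have "uncountable (Sl (k, r))" using aSl a(2) by (auto simp: Z_def)
      then have "uncountable (Sl (k, r) - Z)" using \<open>countable Z\<close> uncountable_minus_countable by blast
      then have "\<not> Sl (k, r) - Z \<subseteq> {a}" by (meson countable_insert countable_empty countable_subset)
      then obtain b where b: "b \<in> Sl (k, r)" "b \<notin> Z" "b \<noteq> a" by blast
      then have bA: "b \<in> A0" by (auto simp: Sl_def)
      have "dist (J a) (J b) \<le> e / 2"
      proof (rule dist_bound)
        fix j
        show "dist (apply_bcontfun (J a) j) (apply_bcontfun (J b) j) \<le> e / 2"
          using small[of a b "y j"] small[of b a "y j"] a b bA inv[OF b(1)] yY[of j] yn[of j]
          unfolding J_apply dist_real_def by (intro abs_leI) auto
      qed
      then show False using sep0[OF a(1) bA] b(3) e by auto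
    qed
  qed
  have "0 \<in> B" by (simp add: B_def)
  then have "D \<noteq> {}" using D(3) by auto
  define q where "q n = inv_into B J (from_nat_into D n)" for n
  have "from_nat_into D n \<in> J ` B" for n using D(2) \<open>D \<noteq> {}\<close> by (meson from_nat_into subsetD)
  then have q: "q n \<in> B" "J (q n) = from_nat_into D n" for n
    unfolding q_def by (auto intro: inv_into_into simp: f_inv_into_f)
  show ?thesis
  proof (intro exI[of _ q] conjI allI impI)
    show "norm (q n) \<le> 1" for n using q(1)[of n] by (simp add: B_def)
    fix p :: "'a \<Rightarrow>\<^sub>L real" and e :: real assume "norm p \<le> 1" "e > 0"
    then have "J p \<in> closure D" using D(3) by (auto simp: B_def)
    then obtain d where "d \<in> D" "dist d (J p) < e" using \<open>e > 0\<close> by (auto simp: closure_approachable)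
    then show "\<exists>n. dist (J p) (J (q n)) < e" using q(2) from_nat_into_surj[OF D(1)] by (metis dist_commute)
  qed
qed

end

section \<open>Smooth approximation of the norm\<close>

locale dense_dual_sequence = dense_unit_sequence Y y
  for Y :: "'a::real_normed_vector set" and y :: "nat \<Rightarrow> 'a" +
  fixes q :: "nat \<Rightarrow> ('a \<Rightarrow>\<^sub>L real)" and s :: real
  assumes qn: "\<And>n. norm (q n) \<le> 1" and s: "s > 0"
    and qdense: "\<And>p e. norm p \<le> 1 \<Longrightarrow> e > 0 \<Longrightarrow> \<exists>n. dist (J p) (J (q n)) < e"
begin

definition C :: "nat \<Rightarrow> (nat \<Rightarrow>\<^sub>C real) set" where
  "C n = convex hull ((\<lambda>i. J (q i)) ` {..n})"

definition u :: "nat \<Rightarrow> ('a \<Rightarrow>\<^sub>L real) \<Rightarrow> real" where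
  "u k p = (if even k then infdist (J p) (C (k div 2)) else 1 + blinfun_apply p (y (k div 2)))"

definition w :: "nat \<Rightarrow> real" where "w k = (1 / 2) ^ Suc k"

definition \<psi> :: "('a \<Rightarrow>\<^sub>L real) \<Rightarrow> real" where "\<psi> p = (\<Sum>k. w k * (u k p)\<^sup>2)"

definition F :: "'a \<Rightarrow> ('a \<Rightarrow>\<^sub>L real) \<Rightarrow> real" where "F x p = blinfun_apply p x - s / 4 * \<psi> p"

text \<open>A smooth substitute for the norm of \<open>Y\<close>: the distances to the finite-dimensional sets
  \<open>C n\<close> force maximising sequences of \<open>F x\<close> to be norm compact, and strict convexity of \<open>\<psi>\<close> makes
  the maximiser unique.\<close>

definition \<Phi> :: "'a \<Rightarrow> real" where "\<Phi> x = (SUP p\<in>cball 0 1. F x p)"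

lemma C_props: "compact (C n)" "convex (C n)" "C n \<noteq> {}" "i \<le> n \<Longrightarrow> J (q i) \<in> C n"
  by (auto simp: C_def finite_imp_compact_convex_hull intro: hull_inc)

lemma w_pos: "w k > 0" and w_sums: "w sums 1"
  using power_half_series unfolding w_def[abs_def] by auto

lemma u_even: "u (2 * n) p = infdist (J p) (C n)" and u_odd: "u (2 * n + 1) p = 1 + blinfun_apply p (y n)"
  by (simp_all add: u_def)

lemma u_bounds:
  assumes p: "norm p \<le> 1"
  shows "0 \<le> u k p" "u k p \<le> 2"
proof -
  have py: "\<bar>blinfun_apply r (y j)\<bar> \<le> 1" if "norm r \<le> 1" for r :: "'a \<Rightarrow>\<^sub>L real" and j
    using blinfun_apply_le_norm[OF that, of "y j"] yn[of j] by linarith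
  show "0 \<le> u k p" using py[OF p, of "k div 2"] infdist_nonneg by (auto simp: u_def abs_le_iff)
  have "infdist (J p) (C n) \<le> dist (J p) (J (q 0))" for n by (rule infdist_le) (simp add: C_props)
  moreover have "dist (J p) (J (q 0)) \<le> 2"
  proof (rule dist_bound)
    show "dist (apply_bcontfun (J p) j) (apply_bcontfun (J (q 0)) j) \<le> 2" for j
      using py[OF p, of j] py[OF qn, of 0 j] by (simp add: J_apply dist_real_def)
  qed
  ultimately show "u k p \<le> 2" using py[OF p, of "k div 2"] by (smt (verit) u_def)
qed

lemma u_midpoint: "u k ((1 / 2) *\<^sub>R (p + p')) \<le> (u k p + u k p') / 2"
  using infdist_midpoint[OF C_props(1,3,2), of "J p" "J p'"]
  by (simp add: u_def J_add J_scale blinfun.scaleR_left blinfun.add_left)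

lemma \<psi>_summable:
  assumes "norm p \<le> 1"
  shows "summable (\<lambda>k. w k * (u k p)\<^sup>2)"
proof (rule summable_comparison_test')
  show "summable (\<lambda>k. w k * 4)" using w_sums by (intro summable_mult2) (rule sums_summable)
  fix k
  have "(u k p)\<^sup>2 \<le> 2\<^sup>2" using u_bounds[OF assms] by (intro power_mono) auto
  then show "norm (w k * (u k p)\<^sup>2) \<le> w k * 4" using w_pos[of k] by simp
qed

lemma \<psi>_bounds:
  assumes "norm p \<le> 1"
  shows "0 \<le> \<psi> p" "\<psi> p \<le> 4"
proof -
  show "0 \<le> \<psi> p" unfolding \<psi>_def using w_pos
    by (intro suminf_nonneg \<psi>_summable assms) (simp add: less_imp_le)
  have "\<psi> p \<le> (\<Sum>k. w k * 4)" unfolding \<psi>_def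
  proof (intro suminf_le \<psi>_summable assms)
    show "summable (\<lambda>k. w k * 4)" using w_sums by (intro summable_mult2) (rule sums_summable)
    fix k
    have "(u k p)\<^sup>2 \<le> 2\<^sup>2" using u_bounds[OF assms] by (intro power_mono) auto
    then show "w k * (u k p)\<^sup>2 \<le> w k * 4" using w_pos[of k] by simp
  qed
  also have "\<dots> = 4" using suminf_mult2[OF sums_summable[OF w_sums], of 4] sums_unique[OF w_sums] by simp
  finally show "\<psi> p \<le> 4" .
qed

lemma \<psi>_midpoint:
  assumes p: "norm p \<le> 1" "norm p' \<le> 1"
  shows "\<psi> ((1 / 2) *\<^sub>R (p + p')) \<le> (\<psi> p + \<psi> p') / 2 - w k * (u k p - u k p')\<^sup>2 / 4"
proof -
  let ?m = "(1 / 2) *\<^sub>R (p + p')"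
  have m: "norm ?m \<le> 1" using norm_triangle_ineq[of p p'] p by simp
  have "w k * (u k p - u k p')\<^sup>2 / 4 \<le> (w k * (u k p)\<^sup>2 + w k * (u k p')\<^sup>2) / 2 - w k * (u k ?m)\<^sup>2" for k
  proof -
    have "(u k ?m)\<^sup>2 \<le> ((u k p + u k p') / 2)\<^sup>2" using u_midpoint u_bounds[OF m] by (intro power_mono)
    also have "\<dots> = ((u k p)\<^sup>2 + (u k p')\<^sup>2) / 2 - (u k p - u k p')\<^sup>2 / 4"
      by (simp add: power2_eq_square field_simps)
    finally have "w k * (u k ?m)\<^sup>2 \<le> w k * (((u k p)\<^sup>2 + (u k p')\<^sup>2) / 2 - (u k p - u k p')\<^sup>2 / 4)"
      using w_pos[of k] by simp
    then show ?thesis by (simp add: algebra_simps)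
  qed
  note le = this
  have sm: "summable (\<lambda>k. (w k * (u k p)\<^sup>2 + w k * (u k p')\<^sup>2) / 2 - w k * (u k ?m)\<^sup>2)"
    by (intro summable_diff summable_divide summable_add \<psi>_summable p m)
  have nn: "0 \<le> (w j * (u j p)\<^sup>2 + w j * (u j p')\<^sup>2) / 2 - w j * (u j ?m)\<^sup>2" for j
    using le[of j] w_pos[of j] by (smt (verit) divide_nonneg_nonneg mult_nonneg_nonneg zero_le_power2)
  have "w k * (u k p - u k p')\<^sup>2 / 4 \<le> (\<Sum>k. (w k * (u k p)\<^sup>2 + w k * (u k p')\<^sup>2) / 2 - w k * (u k ?m)\<^sup>2)"
    using sum_le_suminf[OF sm, of "{k}"] nn by (intro order_trans[OF le[of k]]) auto
  also have "\<dots> = (\<psi> p + \<psi> p') / 2 - \<psi> ?m"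
    unfolding \<psi>_def using p m
    by (simp add: suminf_diff[symmetric] suminf_add suminf_divide[symmetric] \<psi>_summable summable_add summable_divide)
  finally show ?thesis by linarith
qed

lemma F_le_norm:
  assumes "norm p \<le> 1"
  shows "F x p \<le> norm x"
proof -
  have "0 \<le> s / 4 * \<psi> p" using \<psi>_bounds(1)[OF assms] s by simp
  then show ?thesis using blinfun_apply_le_norm[OF assms, of x] unfolding F_def by linarith
qed

lemma F_bdd: "bdd_above (F x ` cball 0 1)"
  by (rule bdd_aboveI2[of _ _ "norm x"]) (simp add: F_le_norm)

lemma F_le_\<Phi>: "norm p \<le> 1 \<Longrightarrow> F x p \<le> \<Phi> x"
  unfolding \<Phi>_def by (rule cSUP_upper[OF _ F_bdd]) simp

lemma F_near_\<Phi>: "r < \<Phi> x \<Longrightarrow> \<exists>p. norm p \<le> 1 \<and> r < F x p"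
  unfolding \<Phi>_def using less_cSUP_iff[OF _ F_bdd, of r x] by auto

lemma \<Phi>_le_norm: "\<Phi> x \<le> norm x"
  unfolding \<Phi>_def by (rule cSUP_least) (auto simp: F_le_norm)

lemma \<Phi>_ge_norm: "norm x - s \<le> \<Phi> x"
proof -
  obtain p :: "'a \<Rightarrow>\<^sub>L real" where p: "norm p \<le> 1" "blinfun_apply p x = norm x" by (rule exists_norming_functional)
  have "s / 4 * \<psi> p \<le> s / 4 * 4" using \<psi>_bounds[OF p(1)] s by (intro mult_left_mono) auto
  then show ?thesis using F_le_\<Phi>[OF p(1), of x] by (simp add: F_def p(2))
qed

lemma \<Phi>_lipschitz: "\<bar>\<Phi> a - \<Phi> b\<bar> \<le> norm (a - b)"
proof -
  have "\<Phi> a \<le> \<Phi> b + norm (a - b)" for a b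
    unfolding \<Phi>_def[of a]
  proof (rule cSUP_least)
    fix p :: "'a \<Rightarrow>\<^sub>L real" assume "p \<in> cball 0 1"
    then have p: "norm p \<le> 1" by simp
    have "F a p = F b p + blinfun_apply p (a - b)" by (simp add: F_def blinfun.diff_right)
    then show "F a p \<le> \<Phi> b + norm (a - b)"
      using F_le_\<Phi>[OF p, of b] blinfun_apply_le_norm[OF p, of "a - b"] by linarith
  qed simp
  from this[of a b] this[of b a] show ?thesis by (simp add: norm_minus_commute abs_le_iff)
qed

lemma near_maximisers_close:
  assumes p: "norm p \<le> 1" "\<Phi> x - e \<le> F x p" and p': "norm p' \<le> 1" "\<Phi> x - e \<le> F x p'"
  shows "w k * (u k p - u k p')\<^sup>2 \<le> 16 * e / s"
proof -
  let ?m = "(1 / 2) *\<^sub>R (p + p')"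
  have m: "norm ?m \<le> 1" using norm_triangle_ineq[of p p'] p p' by simp
  have "s / 4 * \<psi> ?m \<le> s / 4 * ((\<psi> p + \<psi> p') / 2 - w k * (u k p - u k p')\<^sup>2 / 4)"
    using \<psi>_midpoint[OF p(1) p'(1), of k] s by (intro mult_left_mono) auto
  moreover have "F x ?m \<le> \<Phi> x" by (rule F_le_\<Phi>[OF m])
  moreover have "blinfun_apply ?m x = (blinfun_apply p x + blinfun_apply p' x) / 2"
    by (simp add: blinfun.scaleR_left blinfun.add_left)
  ultimately have "s / 4 * (w k * (u k p - u k p')\<^sup>2 / 4) \<le> e"
    using p(2) p'(2) unfolding F_def by (simp add: algebra_simps)
  then show ?thesis using s by (simp add: field_simps)
qed

lemma maximising_u_close:
  assumes "d > 0"
  obtains N where "\<And>e p p'. \<lbrakk>e \<le> 1 / real (Suc N); norm p \<le> 1; \<Phi> x - e \<le> F x p; norm p' \<le> 1; \<Phi> x - e \<le> F x p'\<rbrakk>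
    \<Longrightarrow> \<bar>u k p - u k p'\<bar> < d"
proof -
  have "w k * d\<^sup>2 * s / 16 > 0" using w_pos s assms by simp
  then obtain N where N: "1 / real (Suc N) < w k * d\<^sup>2 * s / 16" using nat_approx_posE by blast
  show thesis
  proof (rule that[of N])
    fix e and p p' :: "'a \<Rightarrow>\<^sub>L real"
    assume e: "e \<le> 1 / real (Suc N)" and p: "norm p \<le> 1" "\<Phi> x - e \<le> F x p" "norm p' \<le> 1" "\<Phi> x - e \<le> F x p'"
    have "w k * (u k p - u k p')\<^sup>2 \<le> 16 * e / s" by (rule near_maximisers_close[OF p])
    also have "\<dots> < w k * d\<^sup>2"
    proof -
      have "e < w k * d\<^sup>2 * s / 16" using e N by linarith
      then show ?thesis using s by (simp add: field_simps)
    qed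
    finally have "(u k p - u k p')\<^sup>2 < d\<^sup>2" using w_pos[of k] by simp
    then show "\<bar>u k p - u k p'\<bar> < d" using assms by (metis abs_of_pos power2_abs power2_less_imp_less less_imp_le)
  qed
qed

lemma pointwise_convergent:
  assumes P: "\<And>n. norm (P n) \<le> 1" and conv: "\<And>k. convergent (\<lambda>n. blinfun_apply (P n) (y k))"
  obtains p :: "'a \<Rightarrow>\<^sub>L real" where "norm p \<le> 1" "\<And>h. h \<in> Y \<Longrightarrow> (\<lambda>n. blinfun_apply (P n) h) \<longlonglongrightarrow> blinfun_apply p h"
proof -
  have conv1: "convergent (\<lambda>n. blinfun_apply (P n) h)" if h: "h \<in> Y" "norm h \<le> 1" for h
    unfolding Cauchy_convergent_iff[symmetric]
  proof (rule metric_CauchyI)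
    fix e :: real assume e: "e > 0"
    obtain k where k: "norm (h - y k) < e / 3" using dense[OF h, of "e / 3"] e by auto
    have "Cauchy (\<lambda>n. blinfun_apply (P n) (y k))" using conv by (simp add: Cauchy_convergent_iff)
    then obtain N where N: "\<And>m n. m \<ge> N \<Longrightarrow> n \<ge> N \<Longrightarrow> dist (blinfun_apply (P m) (y k)) (blinfun_apply (P n) (y k)) < e / 3"
      using metric_CauchyD[of _ "e / 3"] e by (metis zero_less_divide_iff zero_less_numeral)
    have c: "\<bar>blinfun_apply (P n) h - blinfun_apply (P n) (y k)\<bar> < e / 3" for n
      using blinfun_apply_le_norm[OF P[of n], of "h - y k"] k by (simp add: blinfun.diff_right)
    have "dist (blinfun_apply (P m) h) (blinfun_apply (P n) h) < e" if "m \<ge> N" "n \<ge> N" for m n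
      using N[OF that] c[of m] c[of n] unfolding dist_real_def by linarith
    then show "\<exists>M. \<forall>m\<ge>M. \<forall>n\<ge>M. dist (blinfun_apply (P m) h) (blinfun_apply (P n) h) < e" by blast
  qed
  have conv2: "convergent (\<lambda>n. blinfun_apply (P n) h)" if h: "h \<in> Y" for h
  proof -
    define M where "M = max 1 (norm h)"
    have M: "M > 0" "norm h \<le> M" by (auto simp: M_def)
    have "convergent (\<lambda>n. M * blinfun_apply (P n) ((1 / M) *\<^sub>R h))"
      using h M Y by (intro convergent_mult convergent_const conv1) (auto simp: subspace_scale)
    moreover have "M * blinfun_apply (P n) ((1 / M) *\<^sub>R h) = blinfun_apply (P n) h" for n
      using M by (simp add: blinfun.scaleR_right)
    ultimately show ?thesis by simp
  qed
  define L where "L h = lim (\<lambda>n. blinfun_apply (P n) h)" for h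
  have L: "(\<lambda>n. blinfun_apply (P n) h) \<longlonglongrightarrow> L h" if "h \<in> Y" for h
    using conv2[OF that] by (simp add: L_def convergent_LIMSEQ_iff)
  obtain p :: "'a \<Rightarrow>\<^sub>L real" where p: "norm p \<le> 1" "\<And>h. h \<in> Y \<Longrightarrow> blinfun_apply p h = L h"
  proof (rule extend_functional[OF Y, of 1 L])
    show "L (a + b) = L a + L b" if "a \<in> Y" "b \<in> Y" for a b
    proof (rule LIMSEQ_unique)
      show "(\<lambda>n. blinfun_apply (P n) (a + b)) \<longlonglongrightarrow> L (a + b)" by (intro L subspace_add Y that)
      show "(\<lambda>n. blinfun_apply (P n) (a + b)) \<longlonglongrightarrow> L a + L b"
        using tendsto_add[OF L[OF that(1)] L[OF that(2)]] by (simp add: blinfun.add_right)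
    qed
    show "L (t *\<^sub>R a) = t * L a" if "a \<in> Y" for t a
    proof (rule LIMSEQ_unique)
      show "(\<lambda>n. blinfun_apply (P n) (t *\<^sub>R a)) \<longlonglongrightarrow> L (t *\<^sub>R a)" by (intro L subspace_scale Y that)
      show "(\<lambda>n. blinfun_apply (P n) (t *\<^sub>R a)) \<longlonglongrightarrow> t * L a"
        using tendsto_mult[OF tendsto_const L[OF that], of t] by (simp add: blinfun.scaleR_right)
    qed
    show "\<bar>L a\<bar> \<le> 1 * norm a" if "a \<in> Y" for a
      using tendsto_rabs[OF L[OF that]] blinfun_apply_le_norm[OF P] by (intro LIMSEQ_le_const2) auto
  qed auto
  then show thesis using that L by metis
qed

lemma strong_maximiser:
  assumes x: "x \<in> Y"
  obtains p where "norm p \<le> 1"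
    "\<And>e. e > 0 \<Longrightarrow> \<exists>d>0. \<forall>p'. norm p' \<le> 1 \<longrightarrow> \<Phi> x - d < F x p' \<longrightarrow> dist (J p') (J p) \<le> e"
proof -
  have "\<exists>p. norm p \<le> 1 \<and> \<Phi> x - 1 / real (Suc n) < F x p" for n by (rule F_near_\<Phi>) simp
  then obtain P where P: "\<And>n. norm (P n) \<le> 1" "\<And>n. \<Phi> x - 1 / real (Suc n) < F x (P n)" by metis
  have mono: "1 / real (Suc n) \<le> 1 / real (Suc N)" if "N \<le> n" for n N
    using that by (simp add: frac_le)
  have "Cauchy (\<lambda>n. u k (P n))" for k
  proof (rule metric_CauchyI)
    fix e :: real assume "e > 0"
    then obtain N where N: "\<And>d p p'. \<lbrakk>d \<le> 1 / real (Suc N); norm p \<le> 1; \<Phi> x - d \<le> F x p; norm p' \<le> 1; \<Phi> x - d \<le> F x p'\<rbrakk>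
      \<Longrightarrow> \<bar>u k p - u k p'\<bar> < e" using maximising_u_close[of e x k] by metis
    have "\<Phi> x - 1 / real (Suc N) \<le> F x (P n)" if "N \<le> n" for n
      using mono[OF that] P(2)[of n] by linarith
    then show "\<exists>M. \<forall>m\<ge>M. \<forall>n\<ge>M. dist (u k (P m)) (u k (P n)) < e"
      using N[OF order_refl P(1) _ P(1)] unfolding dist_real_def by blast
  qed
  then have uconv: "convergent (\<lambda>n. u k (P n))" for k by (simp add: Cauchy_convergent_iff)
  have "convergent (\<lambda>n. blinfun_apply (P n) (y k))" for k
    using convergent_diff[OF uconv[of "2 * k + 1"] convergent_const[of 1]] unfolding u_odd by simp
  then obtain p where p: "norm p \<le> 1" "\<And>h. h \<in> Y \<Longrightarrow> (\<lambda>n. blinfun_apply (P n) h) \<longlonglongrightarrow> blinfun_apply p h"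
    using pointwise_convergent[of P, OF P(1)] by metis
  have u_le: "u k p \<le> lim (\<lambda>n. u k (P n))" for k
  proof (cases "even k")
    case False
    then obtain j where k: "k = 2 * j + 1" by (rule oddE)
    have "(\<lambda>n. u k (P n)) \<longlonglongrightarrow> u k p"
      unfolding k u_odd by (intro tendsto_intros p(2) yY)
    then show ?thesis by (simp add: limI)
  next
    case True
    then obtain j where k: "k = 2 * j" by (rule evenE)
    show ?thesis
    proof (rule field_le_epsilon)
      fix e :: real assume "e > 0"
      have "(\<lambda>n. u k (P n)) \<longlonglongrightarrow> lim (\<lambda>n. u k (P n))" using uconv by (simp add: convergent_LIMSEQ_iff)
      then have "eventually (\<lambda>n. u k (P n) < lim (\<lambda>n. u k (P n)) + e) sequentially"
        using \<open>e > 0\<close> by (intro order_tendstoD(2)) auto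
      then obtain N where N: "\<And>n. n \<ge> N \<Longrightarrow> u k (P n) < lim (\<lambda>n. u k (P n)) + e"
        by (auto simp: eventually_sequentially)
      show "u k p \<le> lim (\<lambda>n. u k (P n)) + e"
        unfolding k u_even
      proof (rule pointwise_limit_near_compact(1)[OF _ C_props(1,3)])
        show "(\<lambda>n. apply_bcontfun (J (P (n + N))) i) \<longlonglongrightarrow> apply_bcontfun (J p) i" for i
          using LIMSEQ_ignore_initial_segment[OF p(2)[OF yY[of i]], of N] by (simp add: J_apply)
        show "infdist (J (P (n + N))) (C j) \<le> lim (\<lambda>n. infdist (J (P n)) (C j)) + e" for n
          using N[of "n + N"] by (simp add: k u_even)
      qed
    qed
  qed
  have "\<psi> p \<le> 4 / s * (blinfun_apply p x - \<Phi> x)"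
    unfolding \<psi>_def
  proof (rule suminf_le_const[OF \<psi>_summable[OF p(1)]])
    fix N
    have "(\<Sum>k<N. w k * (u k p)\<^sup>2) \<le> (\<Sum>k<N. w k * (lim (\<lambda>n. u k (P n)))\<^sup>2)"
      using u_le u_bounds[OF p(1)] w_pos by (intro sum_mono mult_left_mono power_mono) (auto simp: less_imp_le)
    also have "\<dots> \<le> 4 / s * (blinfun_apply p x - \<Phi> x + 0)"
    proof (rule LIMSEQ_le)
      show "(\<lambda>n. \<Sum>k<N. w k * (u k (P n))\<^sup>2) \<longlonglongrightarrow> (\<Sum>k<N. w k * (lim (\<lambda>n. u k (P n)))\<^sup>2)"
        using uconv by (intro tendsto_sum tendsto_mult tendsto_power tendsto_const) (simp add: convergent_LIMSEQ_iff)
      show "(\<lambda>n. 4 / s * (blinfun_apply (P n) x - \<Phi> x + 1 / real (Suc n))) \<longlonglongrightarrow> 4 / s * (blinfun_apply p x - \<Phi> x + 0)"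
        by (intro tendsto_intros p(2) x) (rule LIMSEQ_Suc[OF lim_1_over_n])
      have "(\<Sum>k<N. w k * (u k (P n))\<^sup>2) \<le> 4 / s * (blinfun_apply (P n) x - \<Phi> x + 1 / real (Suc n))" for n
      proof -
        have "(\<Sum>k<N. w k * (u k (P n))\<^sup>2) \<le> \<psi> (P n)"
          unfolding \<psi>_def using w_pos by (intro sum_le_suminf \<psi>_summable P(1)) (auto simp: less_imp_le)
        also have "\<dots> \<le> 4 / s * (blinfun_apply (P n) x - \<Phi> x + 1 / real (Suc n))"
        proof -
          have "s / 4 * \<psi> (P n) \<le> blinfun_apply (P n) x - \<Phi> x + 1 / real (Suc n)"
            using P(2)[of n] unfolding F_def by linarith
          then have "4 / s * (s / 4 * \<psi> (P n)) \<le> 4 / s * (blinfun_apply (P n) x - \<Phi> x + 1 / real (Suc n))"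
            using s by (intro mult_left_mono) auto
          then show ?thesis using s by simp
        qed
        finally show ?thesis .
      qed
      then show "\<exists>M. \<forall>n\<ge>M. (\<Sum>k<N. w k * (u k (P n))\<^sup>2) \<le> 4 / s * (blinfun_apply (P n) x - \<Phi> x + 1 / real (Suc n))"
        by blast
    qed
    finally show "(\<Sum>k<N. w k * (u k p)\<^sup>2) \<le> 4 / s * (blinfun_apply p x - \<Phi> x)" by simp
  qed
  then have "s / 4 * \<psi> p \<le> s / 4 * (4 / s * (blinfun_apply p x - \<Phi> x))" using s by (intro mult_left_mono) auto
  then have max: "\<Phi> x \<le> F x p" using s by (simp add: F_def)
  show thesis
  proof (rule that[OF p(1)], rule ccontr)
    fix e :: real assume e: "e > 0"
      and "\<not> (\<exists>d>0. \<forall>p'. norm p' \<le> 1 \<longrightarrow> \<Phi> x - d < F x p' \<longrightarrow> dist (J p') (J p) \<le> e)"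
    then have "\<exists>p'. norm p' \<le> 1 \<and> \<Phi> x - 1 / real (Suc n) < F x p' \<and> e < dist (J p') (J p)" for n
      by (metis not_le of_nat_0_less_iff zero_less_Suc zero_less_divide_1_iff)
    then obtain R where R: "\<And>n. norm (R n) \<le> 1" "\<And>n. \<Phi> x - 1 / real (Suc n) < F x (R n)"
      "\<And>n. e < dist (J (R n)) (J p)" by metis
    have ulim: "(\<lambda>n. u k (R n)) \<longlonglongrightarrow> u k p" for k
      unfolding lim_sequentially
    proof (intro allI impI)
      fix d :: real assume "d > 0"
      then obtain N where N: "\<And>e p p'. \<lbrakk>e \<le> 1 / real (Suc N); norm p \<le> 1; \<Phi> x - e \<le> F x p; norm p' \<le> 1; \<Phi> x - e \<le> F x p'\<rbrakk>
        \<Longrightarrow> \<bar>u k p - u k p'\<bar> < d" using maximising_u_close[of d x k] by metis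
      have "dist (u k (R n)) (u k p) < d" if "n \<ge> N" for n
        unfolding dist_real_def
      proof (rule N[OF order_refl R(1) _ p(1)])
        show "\<Phi> x - 1 / real (Suc N) \<le> F x (R n)" using mono[OF that] R(2)[of n] by linarith
        have "0 \<le> 1 / real (Suc N)" by simp
        then show "\<Phi> x - 1 / real (Suc N) \<le> F x p" using max by linarith
      qed
      then show "\<exists>N. \<forall>n\<ge>N. dist (u k (R n)) (u k p) < d" by blast
    qed
    obtain j where j: "dist (J p) (J (q j)) < e / 8" using qdense[OF p(1), of "e / 8"] e by auto
    have "u (2 * j) p < e / 4" using infdist_le[OF C_props(4)[OF order_refl], of "J p" j] j e by (simp add: u_even)
    then have "eventually (\<lambda>n. u (2 * j) (R n) < e / 4) sequentially" by (rule order_tendstoD(2)[OF ulim])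
    then obtain N where N: "\<And>n. n \<ge> N \<Longrightarrow> u (2 * j) (R n) < e / 4" by (auto simp: eventually_sequentially)
    have "\<exists>n. dist (J (R (n + N))) (J p) \<le> 2 * (e / 4) + e / 4"
    proof (rule pointwise_limit_near_compact(2)[OF _ C_props(1,3)])
      show "(\<lambda>n. apply_bcontfun (J (R (n + N))) i) \<longlonglongrightarrow> apply_bcontfun (J p) i" for i
        using LIMSEQ_ignore_initial_segment[OF tendsto_diff[OF ulim[of "2 * i + 1"] tendsto_const[of 1]], of N]
        unfolding u_odd by (simp add: J_apply)
      show "infdist (J (R (n + N))) (C j) \<le> e / 4" for n using N[of "n + N"] by (simp add: u_even)
    qed (use e in auto)
    then obtain n where "dist (J (R (n + N))) (J p) \<le> 2 * (e / 4) + e / 4" by blast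
    then show False using R(3)[of "n + N"] e by linarith
  qed
qed

lemma \<Phi>_upper_differentiable:
  assumes x: "x \<in> Y"
  obtains p where "norm p \<le> 1"
    "\<And>e. e > 0 \<Longrightarrow> \<exists>d>0. \<forall>h\<in>Y. norm h < d \<longrightarrow> \<Phi> (x + h) \<le> \<Phi> x + blinfun_apply p h + e * norm h"
proof -
  obtain p where p: "norm p \<le> 1"
    and strong: "\<And>e. e > 0 \<Longrightarrow> \<exists>d>0. \<forall>p'. norm p' \<le> 1 \<longrightarrow> \<Phi> x - d < F x p' \<longrightarrow> dist (J p') (J p) \<le> e"
    using strong_maximiser[OF x] by metis
  show thesis
  proof (rule that[OF p])
    fix e :: real assume "e > 0"
    then obtain d where d: "d > 0" "\<And>p'. norm p' \<le> 1 \<Longrightarrow> \<Phi> x - d < F x p' \<Longrightarrow> dist (J p') (J p) \<le> e"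
      using strong by metis
    have "\<Phi> (x + h) \<le> \<Phi> x + blinfun_apply p h + e * norm h" if h: "h \<in> Y" "norm h < d / 3" for h
    proof (rule field_le_epsilon)
      fix \<eta> :: real assume "\<eta> > 0"
      define \<eta>' where "\<eta>' = min \<eta> (d / 3)"
      have \<eta>': "\<eta>' > 0" "\<eta>' \<le> \<eta>" "\<eta>' \<le> d / 3" using \<open>\<eta> > 0\<close> d by (auto simp: \<eta>'_def)
      obtain p' where p': "norm p' \<le> 1" "\<Phi> (x + h) - \<eta>' < F (x + h) p'"
        using F_near_\<Phi>[of "\<Phi> (x + h) - \<eta>'" "x + h"] \<eta>' by auto
      have Fx: "F (x + h) p' = F x p' + blinfun_apply p' h" by (simp add: F_def blinfun.add_right)
      have "\<Phi> x - norm h \<le> \<Phi> (x + h)" using \<Phi>_lipschitz[of x "x + h"] by simp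
      then have "\<Phi> x - d < F x p'"
        using p'(2) Fx \<eta>' h(2) blinfun_apply_le_norm[OF p'(1), of h] by linarith
      then have "dist (J p') (J p) \<le> e" by (rule d(2)[OF p'(1)])
      then have "dist (J p') (J p) * norm h \<le> e * norm h" by (intro mult_right_mono) auto
      then have "blinfun_apply p' h \<le> blinfun_apply p h + e * norm h"
        using apply_diff_le_dist_J[OF h(1), of p' p] by linarith
      then show "\<Phi> (x + h) \<le> \<Phi> x + blinfun_apply p h + e * norm h + \<eta>"
        using p'(2) Fx F_le_\<Phi>[OF p'(1), of x] \<eta>' by linarith
    qed
    then show "\<exists>d>0. \<forall>h\<in>Y. norm h < d \<longrightarrow> \<Phi> (x + h) \<le> \<Phi> x + blinfun_apply p h + e * norm h"
      using d(1) by (intro exI[of _ "d / 3"]) auto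
  qed
qed

end

theorem (in dense_unit_sequence) smooth_norm_approximation:
  assumes asp: "asplund TYPE('a)" and s: "s > 0"
  obtains \<phi> :: "'a \<Rightarrow> real" where "\<phi> 0 = 0" "\<And>a b. \<bar>\<phi> a - \<phi> b\<bar> \<le> norm (a - b)" "\<And>z. norm z - s \<le> \<phi> z"
    "\<And>x. x \<in> Y \<Longrightarrow> \<exists>p. norm p \<le> 1 \<and>
      (\<forall>e>0. \<exists>d>0. \<forall>h\<in>Y. norm h < d \<longrightarrow> \<phi> (x + h) \<le> \<phi> x + blinfun_apply p h + e * norm h)"
proof -
  obtain q :: "nat \<Rightarrow> _" where q: "\<forall>n. norm (q n) \<le> 1"
    "\<forall>p e. norm p \<le> 1 \<longrightarrow> e > 0 \<longrightarrow> (\<exists>n. dist (J p) (J (q n)) < e)"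
    using dual_separable[OF asp] by (elim exE conjE)
  interpret dense_dual_sequence Y y q s by unfold_locales (use q s in auto)
  show thesis
  proof (rule that[of "\<lambda>x. \<Phi> x - \<Phi> 0"])
    show "\<bar>(\<Phi> a - \<Phi> 0) - (\<Phi> b - \<Phi> 0)\<bar> \<le> norm (a - b)" for a b using \<Phi>_lipschitz[of a b] by simp
    show "norm z - s \<le> \<Phi> z - \<Phi> 0" for z using \<Phi>_ge_norm[of z] \<Phi>_le_norm[of 0] by simp
    fix x assume "x \<in> Y"
    then obtain p where p: "norm p \<le> 1"
      "\<And>e. e > 0 \<Longrightarrow> \<exists>d>0. \<forall>h\<in>Y. norm h < d \<longrightarrow> \<Phi> (x + h) \<le> \<Phi> x + blinfun_apply p h + e * norm h"
      using \<Phi>_upper_differentiable by metis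
    show "\<exists>p. norm p \<le> 1 \<and> (\<forall>e>0. \<exists>d>0. \<forall>h\<in>Y. norm h < d \<longrightarrow>
        \<Phi> (x + h) - \<Phi> 0 \<le> \<Phi> x - \<Phi> 0 + blinfun_apply p h + e * norm h)"
    proof (intro exI[of _ p] conjI allI impI p(1))
      fix e :: real assume "e > 0"
      then obtain d where "d > 0" "\<forall>h\<in>Y. norm h < d \<longrightarrow> \<Phi> (x + h) \<le> \<Phi> x + blinfun_apply p h + e * norm h"
        using p(2) by metis
      then show "\<exists>d>0. \<forall>h\<in>Y. norm h < d \<longrightarrow> \<Phi> (x + h) - \<Phi> 0 \<le> \<Phi> x - \<Phi> 0 + blinfun_apply p h + e * norm h"
        by (intro exI[of _ d]) auto
    qed
  qed simp
qed

section \<open>Separable reduction of Frechet subdifferentiability\<close>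

lemma countable_closed_superset:
  fixes W :: "'a \<Rightarrow> 'a \<Rightarrow> 'a set"
  assumes "\<And>a b. countable (W a b)"
  obtains D where "countable D" "x0 \<in> D" "\<And>a b. a \<in> D \<Longrightarrow> b \<in> D \<Longrightarrow> W a b \<subseteq> D"
proof -
  define S where "S n = ((\<lambda>A. A \<union> (\<Union>a\<in>A. \<Union>b\<in>A. W a b)) ^^ n) {x0}" for n
  have S0: "S 0 = {x0}" and SSuc: "S (Suc n) = S n \<union> (\<Union>a\<in>S n. \<Union>b\<in>S n. W a b)" for n
    by (auto simp: S_def)
  have "countable (S n)" for n
    by (induction n) (auto simp: S0 SSuc assms)
  moreover have mono: "S m \<subseteq> S n" if "m \<le> n" for m n
    using that by (rule lift_Suc_mono_le[of S, rotated]) (auto simp: SSuc)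
  moreover have "W a b \<subseteq> (\<Union>n. S n)" if "a \<in> (\<Union>n. S n)" "b \<in> (\<Union>n. S n)" for a b
  proof -
    obtain m n where "a \<in> S m" "b \<in> S n"
      using \<open>a \<in> (\<Union>n. S n)\<close> \<open>b \<in> (\<Union>n. S n)\<close> by blast
    then have "a \<in> S (max m n)" "b \<in> S (max m n)" using mono[of m "max m n"] mono[of n "max m n"] by auto
    then have "W a b \<subseteq> S (Suc (max m n))" by (auto simp: SSuc)
    then show ?thesis by blast
  qed
  moreover have "x0 \<in> (\<Union>n. S n)" using S0 by blast
  ultimately show thesis by (intro that[of "\<Union>n. S n"] countable_UN) auto
qed

lemma subspace_closure_rational:
  fixes D :: "'a::real_normed_vector set"
  assumes ne: "D \<noteq> {}" and add: "\<And>a b. a \<in> D \<Longrightarrow> b \<in> D \<Longrightarrow> a + b \<in> D"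
    and scale: "\<And>a r. a \<in> D \<Longrightarrow> real_of_rat r *\<^sub>R a \<in> D"
  shows "subspace (closure D)"
proof (rule subspaceI)
  obtain a where "a \<in> D" using ne by blast
  then show "0 \<in> closure D" using scale[of a 0] closure_subset by auto
  show "a + b \<in> closure D" if "a \<in> closure D" "b \<in> closure D" for a b
  proof -
    obtain A B where "\<forall>n. A n \<in> D" "A \<longlonglongrightarrow> a" "\<forall>n. B n \<in> D" "B \<longlonglongrightarrow> b"
      using \<open>a \<in> closure D\<close> \<open>b \<in> closure D\<close> unfolding closure_sequential by blast
    then show ?thesis unfolding closure_sequential
      by (intro exI[of _ "\<lambda>n. A n + B n"]) (auto intro: add tendsto_add)
  qed
  show "t *\<^sub>R a \<in> closure D" if "a \<in> closure D" for t a
  proof -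
    obtain A where A: "\<forall>n. A n \<in> D" "A \<longlonglongrightarrow> a"
      using \<open>a \<in> closure D\<close> unfolding closure_sequential by blast
    have "\<exists>r. t < real_of_rat r \<and> real_of_rat r < t + 1 / real (Suc n)" for n
      by (rule of_rat_dense) simp
    then obtain r where r: "\<And>n. t < real_of_rat (r n)" "\<And>n. real_of_rat (r n) < t + 1 / real (Suc n)" by metis
    have "(\<lambda>n. t + 1 / real (Suc n)) \<longlonglongrightarrow> t + 0"
      by (intro tendsto_intros LIMSEQ_Suc[OF lim_1_over_n])
    then have lim: "(\<lambda>n. t + 1 / real (Suc n)) \<longlonglongrightarrow> t" by simp
    have "(\<lambda>n. real_of_rat (r n)) \<longlonglongrightarrow> t"
    proof (rule tendsto_sandwich[OF _ _ tendsto_const lim])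
      show "\<forall>\<^sub>F n in sequentially. t \<le> real_of_rat (r n)"
        using r(1) by (intro always_eventually allI less_imp_le)
      show "\<forall>\<^sub>F n in sequentially. real_of_rat (r n) \<le> t + 1 / real (Suc n)"
        using r(2) by (intro always_eventually allI less_imp_le)
    qed
    then show ?thesis using A unfolding closure_sequential
      by (intro exI[of _ "\<lambda>n. real_of_rat (r n) *\<^sub>R A n"]) (auto intro: scale tendsto_scaleR)
  qed
qed

lemma dense_unit_sequence_exists:
  fixes D :: "'a::real_normed_vector set"
  assumes D: "countable D" "D \<noteq> {}" and Y: "subspace (closure D)"
  obtains y where "dense_unit_sequence (closure D) y"
proof -
  define P where "P d = (1 / max 1 (norm d)) *\<^sub>R d" for d :: 'a
  define y where "y n = P (from_nat_into D n)" for n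
  have "dense_unit_sequence (closure D) y"
  proof unfold_locales
    show "subspace (closure D)" by (rule Y)
    have "from_nat_into D k \<in> closure D" for k using from_nat_into[OF D(2)] closure_subset by blast
    then show "y k \<in> closure D" for k using Y by (simp add: y_def P_def subspace_scale)
    show "norm (y k) \<le> 1" for k by (simp add: y_def P_def divide_le_eq)
    fix h and e :: real assume h: "h \<in> closure D" "norm h \<le> 1" and e: "e > 0"
    obtain A where A: "\<forall>n. A n \<in> D" "A \<longlonglongrightarrow> h" using h(1) unfolding closure_sequential by blast
    have "(\<lambda>n. P (A n)) \<longlonglongrightarrow> P h" unfolding P_def by (intro tendsto_intros A(2)) auto
    moreover have "P h = h" using h(2) by (simp add: P_def max_def)
    ultimately obtain n where "dist (P (A n)) h < e" using e by (metis lim_sequentially order_refl)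
    moreover obtain k where "from_nat_into D k = A n" using from_nat_into_surj[OF D(1)] A(1) by metis
    ultimately show "\<exists>k. norm (h - y k) < e"
      by (intro exI[of _ k]) (simp add: y_def dist_norm norm_minus_commute)
  qed
  then show thesis by (rule that)
qed

definition frechet_subgradient :: "'a::real_normed_vector set \<Rightarrow> ('a \<Rightarrow> real) \<Rightarrow> 'a \<Rightarrow> ('a \<Rightarrow>\<^sub>L real) \<Rightarrow> bool" where
  "frechet_subgradient D f x p \<longleftrightarrow>
     (\<forall>e>0. \<exists>d>0. \<forall>h. x + h \<in> D \<longrightarrow> norm h < d \<longrightarrow> f x + blinfun_apply p h - e * norm h \<le> f (x + h))"

text \<open>A Frechet subgradient of norm at most \<open>c\<close> at \<open>x\<close> separates the convex hull of
  \<open>subgradient_test_set\<close> (for \<open>z = x\<close>, \<open>r = f x\<close> and some infinite sequence of radii \<open>\<delta>\<close>) from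
  \<open>{(h, t). t < - c * norm h}\<close>. A violation of separation involves finitely many points and is stable
  under perturbation of \<open>z\<close> and \<open>r\<close>, so it can be reproduced in a suitable separable subspace.\<close>

definition subgradient_test_set :: "'a::real_normed_vector set \<Rightarrow> ('a \<Rightarrow> real) \<Rightarrow> 'a \<Rightarrow> rat \<Rightarrow> rat list \<Rightarrow> 'a set \<Rightarrow> ('a \<times> real) set" where
  "subgradient_test_set Dm f z r \<delta> T = {(w - z, t) |w t. w \<in> T \<and> w \<in> Dm \<and>
     (\<exists>n < length \<delta>. norm (w - z) < real_of_rat (\<delta> ! n) \<and> f w - real_of_rat r + norm (w - z) / real (Suc n) \<le> t)}"

definition subgradient_violation :: "'a::real_normed_vector set \<Rightarrow> ('a \<Rightarrow> real) \<Rightarrow> real \<Rightarrow> 'a \<Rightarrow> rat \<Rightarrow> rat list \<Rightarrow> nat \<Rightarrow> 'a set \<Rightarrow> bool" where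
  "subgradient_violation Dm f c z r \<delta> k T \<longleftrightarrow>
     (\<exists>h t. (h, t) \<in> convex hull subgradient_test_set Dm f z r \<delta> T \<and> t < - c * norm h - 1 / real (Suc k))"

lemma convex_hull_finite_subset:
  assumes "x \<in> convex hull E"
  obtains S where "finite S" "S \<subseteq> E" "x \<in> convex hull S"
proof -
  obtain S u where "finite S" "S \<subseteq> E" "\<forall>x\<in>S. 0 \<le> u x" "sum u S = 1" "sum (\<lambda>v. u v *\<^sub>R v) S = x"
    using assms unfolding convex_hull_explicit by blast
  then show thesis using that[of S] convex_hull_finite[of S] by blast
qed

lemma subgradient_violation_finite:
  assumes "subgradient_violation Dm f c z r \<delta> k UNIV"
  shows "\<exists>T. finite T \<and> subgradient_violation Dm f c z r \<delta> k T"
proof -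
  obtain h t where ht: "(h, t) \<in> convex hull subgradient_test_set Dm f z r \<delta> UNIV" "t < - c * norm h - 1 / real (Suc k)"
    using assms unfolding subgradient_violation_def by blast
  obtain S where S: "finite S" "S \<subseteq> subgradient_test_set Dm f z r \<delta> UNIV" "(h, t) \<in> convex hull S"
    using convex_hull_finite_subset[OF ht(1)] by metis
  define T where "T = (\<lambda>v. fst v + z) ` S"
  have "S \<subseteq> subgradient_test_set Dm f z r \<delta> T"
    using S(2) unfolding subgradient_test_set_def T_def by force
  then have "(h, t) \<in> convex hull subgradient_test_set Dm f z r \<delta> T" using S(3) hull_mono by blast
  then show ?thesis using S(1) ht(2) unfolding subgradient_violation_def T_def by blast
qed

theorem separable_reduction:
  fixes f :: "'a::real_normed_vector \<Rightarrow> real"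
  assumes c: "0 \<le> c"
  obtains D where "countable D" "x0 \<in> D" "subspace (closure D)"
    "\<And>x p. x \<in> closure D \<Longrightarrow> norm p \<le> c \<Longrightarrow> frechet_subgradient (Dm \<inter> closure D) f x p \<Longrightarrow>
       \<exists>p'. norm p' \<le> c \<and> frechet_subgradient Dm f x p'"
proof -
  define V where "V z i = (case i of (r, \<delta>, k) \<Rightarrow> SOME T. finite T \<and>
    (subgradient_violation Dm f c z r \<delta> k UNIV \<longrightarrow> subgradient_violation Dm f c z r \<delta> k T))" for z i
  have V: "finite (V z (r, \<delta>, k))"
    "subgradient_violation Dm f c z r \<delta> k UNIV \<Longrightarrow> subgradient_violation Dm f c z r \<delta> k (V z (r, \<delta>, k))" for z r \<delta> k
  proof -
    have "\<exists>T. finite T \<and> (subgradient_violation Dm f c z r \<delta> k UNIV \<longrightarrow> subgradient_violation Dm f c z r \<delta> k T)"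
      using subgradient_violation_finite[of Dm f c z r \<delta> k] finite.emptyI by blast
    from someI_ex[OF this] show "finite (V z (r, \<delta>, k))"
      "subgradient_violation Dm f c z r \<delta> k UNIV \<Longrightarrow> subgradient_violation Dm f c z r \<delta> k (V z (r, \<delta>, k))"
      unfolding V_def by auto
  qed
  define W where "W a b = {a + b} \<union> range (\<lambda>r. real_of_rat r *\<^sub>R a) \<union> (\<Union>i. V a i)" for a b
  have "countable (W a b)" for a b
  proof -
    have "countable (V a i)" for i using V(1) by (cases i) (auto intro: countable_finite)
    then show ?thesis unfolding W_def by auto
  qed
  then obtain D where D: "countable D" "x0 \<in> D" and DW: "\<And>a b. a \<in> D \<Longrightarrow> b \<in> D \<Longrightarrow> W a b \<subseteq> D"
    using countable_closed_superset[of W x0] by metis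
  have DV: "V a i \<subseteq> D" if "a \<in> D" for a i using DW[OF that that] by (auto simp: W_def)
  have sub: "subspace (closure D)"
    using D(2) DW by (intro subspace_closure_rational) (force simp: W_def)+
  define Y where "Y = closure D"
  have DY: "D \<subseteq> Y" by (simp add: Y_def closure_subset)
  have main: "\<exists>p'. norm p' \<le> c \<and> frechet_subgradient Dm f x p'"
    if x: "x \<in> Y" and p: "norm p \<le> c" and fr: "frechet_subgradient (Dm \<inter> Y) f x p" for x p
  proof -
    have "\<exists>d>0. \<forall>h. x + h \<in> Dm \<inter> Y \<longrightarrow> norm h < d \<longrightarrow> f x + blinfun_apply p h - 1 / real (Suc n) * norm h \<le> f (x + h)" for n
      using fr[unfolded frechet_subgradient_def, rule_format, of "1 / real (Suc n)"] by simp
    then obtain \<delta> where \<delta>: "\<And>n. \<delta> n > 0"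
      "\<And>n h. x + h \<in> Dm \<inter> Y \<Longrightarrow> norm h < \<delta> n \<Longrightarrow> f x + blinfun_apply p h - 1 / real (Suc n) * norm h \<le> f (x + h)"
      by metis
    have "\<exists>r. 0 < real_of_rat r \<and> real_of_rat r < \<delta> n" for n using of_rat_dense[OF \<delta>(1)] by blast
    then obtain \<rho> where \<rho>: "\<And>n. 0 < real_of_rat (\<rho> n)" "\<And>n. real_of_rat (\<rho> n) < \<delta> n" by metis
    define E where "E = {(h, t). x + h \<in> Dm \<and> (\<exists>n. norm h < real_of_rat (\<rho> n) / 2 \<and> f (x + h) - f x + norm h / real (Suc n) \<le> t)}"
    have sep: "- c * norm h \<le> t" if ht: "(h, t) \<in> convex hull E" for h t
    proof (rule ccontr)
      assume neg: "\<not> - c * norm h \<le> t"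
      define g where "g = - c * norm h - t"
      have g: "g > 0" using neg by (simp add: g_def)
      obtain S where S: "finite S" "S \<subseteq> E" "(h, t) \<in> convex hull S" using convex_hull_finite_subset[OF ht] by metis
      have "\<exists>n. norm (fst v) < real_of_rat (\<rho> n) / 2 \<and> f (x + fst v) - f x + norm (fst v) / real (Suc n) \<le> snd v"
        if "v \<in> S" for v using subsetD[OF S(2) that] by (simp add: E_def case_prod_unfold)
      then obtain \<nu> where \<nu>: "\<And>v. v \<in> S \<Longrightarrow> norm (fst v) < real_of_rat (\<rho> (\<nu> v)) / 2"
        "\<And>v. v \<in> S \<Longrightarrow> f (x + fst v) - f x + norm (fst v) / real (Suc (\<nu> v)) \<le> snd v" by metis
      obtain N where N: "\<And>v. v \<in> S \<Longrightarrow> \<nu> v < N"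
        using finite_nat_set_iff_bounded[of "\<nu> ` S"] S(1) by auto
      define \<Delta> where "\<Delta> = map \<rho> [0..<N]"
      have \<Delta>: "length \<Delta> = N" "\<And>n. n < N \<Longrightarrow> \<Delta> ! n = \<rho> n" by (auto simp: \<Delta>_def)
      obtain k where k: "1 / real (Suc k) < g / 2" using nat_approx_posE[of "g / 2"] g by auto
      define m where "m = Min (insert (1 / (real (Suc k) * (c + 3))) ((\<lambda>n. min (real_of_rat (\<rho> n) / 2) (\<delta> n - real_of_rat (\<rho> n))) ` {..<N}))"
      have "m > 0" unfolding m_def using \<rho> c by (subst Min_gr_iff) auto
      have m1: "m \<le> 1 / (real (Suc k) * (c + 3))" unfolding m_def by (rule Min_le) auto
      have m2: "m \<le> real_of_rat (\<rho> n) / 2" "m \<le> \<delta> n - real_of_rat (\<rho> n)" if "n < N" for n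
      proof -
        have "m \<le> min (real_of_rat (\<rho> n) / 2) (\<delta> n - real_of_rat (\<rho> n))"
          unfolding m_def using that by (intro Min_le) auto
        then show "m \<le> real_of_rat (\<rho> n) / 2" "m \<le> \<delta> n - real_of_rat (\<rho> n)" by auto
      qed
      have cm: "(c + 2) * m < 1 / real (Suc k)"
      proof -
        have "(c + 2) * m < (c + 3) * m" using \<open>m > 0\<close> by simp
        also have "\<dots> \<le> (c + 3) * (1 / (real (Suc k) * (c + 3)))" using m1 c by (intro mult_left_mono) auto
        also have "\<dots> = 1 / real (Suc k)" using c by simp
        finally show ?thesis .
      qed
      obtain z where z: "z \<in> D" "norm (x - z) < m"
        using x \<open>m > 0\<close> unfolding Y_def closure_approachable by (metis dist_norm norm_minus_commute)
      obtain r where r: "f x - m < real_of_rat r" "real_of_rat r < f x" using of_rat_dense[of "f x - m" "f x"] \<open>m > 0\<close> by auto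
      have quot: "norm a / real (Suc n) \<le> norm b / real (Suc n) + norm (a - b)" for a b :: 'a and n
      proof -
        have "norm a / real (Suc n) \<le> (norm b + norm (a - b)) / real (Suc n)"
          using norm_triangle_sub[of a b] by (intro divide_right_mono) auto
        also have "\<dots> \<le> norm b / real (Suc n) + norm (a - b)"
          using frac_le[of "norm (a - b)" "norm (a - b)" 1 "real (Suc n)"] by (simp add: add_divide_distrib)
        finally show ?thesis .
      qed
      have inE: "(x - z, 2 * m) + v \<in> subgradient_test_set Dm f z r \<Delta> UNIV" if v: "v \<in> S" for v
      proof -
        let ?w = "x + fst v"
        have w: "?w - z = fst v + (x - z)" by simp
        have "norm (?w - z) < real_of_rat (\<Delta> ! \<nu> v)"
          using norm_triangle_ineq[of "fst v" "x - z"] \<nu>(1)[OF v] z(2) m2(1)[OF N[OF v]]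
          unfolding w \<Delta>(2)[OF N[OF v]] by linarith
        moreover have "f ?w - real_of_rat r + norm (?w - z) / real (Suc (\<nu> v)) \<le> snd v + 2 * m"
          using quot[of "?w - z" "\<nu> v" "fst v"] \<nu>(2)[OF v] r z(2) by simp
        moreover have "?w \<in> Dm" using subsetD[OF S(2) v] by (simp add: E_def case_prod_unfold)
        ultimately have "(?w - z, snd v + 2 * m) \<in> subgradient_test_set Dm f z r \<Delta> UNIV"
          unfolding subgradient_test_set_def using N[OF v] \<Delta>(1) by blast
        then show ?thesis by (simp add: plus_prod_def algebra_simps)
      qed
      have "(x - z, 2 * m) + (h, t) \<in> convex hull ((+) (x - z, 2 * m) ` S)"
        unfolding convex_hull_translation using S(3) by blast
      moreover have "(+) (x - z, 2 * m) ` S \<subseteq> subgradient_test_set Dm f z r \<Delta> UNIV" using inE by blast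
      ultimately have hull: "(x - z + h, 2 * m + t) \<in> convex hull subgradient_test_set Dm f z r \<Delta> UNIV"
        using hull_mono by fastforce
      have "c * norm (x - z + h) \<le> c * (m + norm h)"
        using norm_triangle_ineq[of "x - z" h] z(2) c by (intro mult_left_mono) auto
      then have "2 * m + t < - c * norm (x - z + h) - 1 / real (Suc k)"
        using cm k g_def by (simp add: algebra_simps)
      then have "subgradient_violation Dm f c z r \<Delta> k UNIV"
        using hull unfolding subgradient_violation_def by blast
      then have "subgradient_violation Dm f c z r \<Delta> k (V z (r, \<Delta>, k))" by (rule V(2))
      then obtain h' t' where h': "(h', t') \<in> convex hull subgradient_test_set Dm f z r \<Delta> (V z (r, \<Delta>, k))"
        "t' < - c * norm h' - 1 / real (Suc k)" unfolding subgradient_violation_def by blast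
      define H where "H = {v. blinfun_apply p (fst v) - snd v \<le> 2 * m - blinfun_apply p (z - x)}"
      have "convex H"
        unfolding convex_def
      proof (intro ballI allI impI)
        fix a b and s u :: real assume ab: "a \<in> H" "b \<in> H" and su: "0 \<le> s" "0 \<le> u" "s + u = 1"
        let ?K = "2 * m - blinfun_apply p (z - x)"
        have "s * (blinfun_apply p (fst a) - snd a) + u * (blinfun_apply p (fst b) - snd b) \<le> s * ?K + u * ?K"
          using ab su by (intro add_mono mult_left_mono) (auto simp: H_def)
        also have "\<dots> = ?K" using su(3) by (metis distrib_right mult_1)
        finally show "s *\<^sub>R a + u *\<^sub>R b \<in> H"
          unfolding H_def by (simp add: blinfun.add_right blinfun.scaleR_right algebra_simps)
      qed
      moreover have "subgradient_test_set Dm f z r \<Delta> (V z (r, \<Delta>, k)) \<subseteq> H"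
      proof
        fix v assume "v \<in> subgradient_test_set Dm f z r \<Delta> (V z (r, \<Delta>, k))"
        then obtain w s n where v: "v = (w - z, s)" "w \<in> V z (r, \<Delta>, k)" "w \<in> Dm" "n < N"
          "norm (w - z) < real_of_rat (\<rho> n)" "f w - real_of_rat r + norm (w - z) / real (Suc n) \<le> s"
          unfolding subgradient_test_set_def using \<Delta> by auto
        have wY: "w \<in> Y" using DV[OF z(1)] v(2) DY by blast
        have "norm (w - x) < \<delta> n"
          using norm_triangle_ineq4[of "w - z" "x - z"] v(5) z(2) m2(2)[OF v(4)] by simp
        then have "f x + blinfun_apply p (w - x) - 1 / real (Suc n) * norm (w - x) \<le> f w"
          using \<delta>(2)[of "w - x" n] wY v(3) by simp
        then have "blinfun_apply p (w - x) \<le> s + 2 * m"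
          using quot[of "w - x" n "w - z"] v(6) r z(2) by (simp add: norm_minus_commute)
        moreover have "blinfun_apply p (w - x) = blinfun_apply p (w - z) + blinfun_apply p (z - x)"
          by (simp add: blinfun.diff_right)
        ultimately show "v \<in> H" by (simp add: H_def v(1))
      qed
      ultimately have "(h', t') \<in> H" using h'(1) hull_minimal[of _ H convex] by blast
      then have 1: "blinfun_apply p h' + blinfun_apply p (z - x) \<le> t' + 2 * m" by (simp add: H_def)
      have pn: "\<bar>blinfun_apply p a\<bar> \<le> c * norm a" for a
        using norm_blinfun[of p a] mult_right_mono[OF p norm_ge_zero[of a]] by simp
      have "c * norm (z - x) \<le> c * m" using z(2) c by (intro mult_left_mono) (auto simp: norm_minus_commute)
      then have "1 / real (Suc k) < (c + 2) * m"
        using 1 pn[of h'] pn[of "z - x"] h'(2) by (simp add: algebra_simps abs_le_iff)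
      then show False using cm by simp
    qed
    obtain p' :: "'a \<Rightarrow>\<^sub>L real" where p': "norm p' \<le> c" "\<And>h t. (h, t) \<in> convex hull E \<Longrightarrow> blinfun_apply p' h \<le> t"
      using sandwich_functional[OF convex_convex_hull c sep] by metis
    have "frechet_subgradient Dm f x p'"
      unfolding frechet_subgradient_def
    proof (intro allI impI)
      fix e :: real assume "e > 0"
      then obtain n where n: "1 / real (Suc n) < e" using nat_approx_posE by blast
      have "f x + blinfun_apply p' h - e * norm h \<le> f (x + h)" if h: "x + h \<in> Dm" "norm h < real_of_rat (\<rho> n) / 2" for h
      proof -
        have "(h, f (x + h) - f x + norm h / real (Suc n)) \<in> E" using h by (auto simp: E_def)
        then have "blinfun_apply p' h \<le> f (x + h) - f x + norm h / real (Suc n)" by (intro p'(2) hull_inc)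
        moreover have "1 / real (Suc n) * norm h \<le> e * norm h" using n by (intro mult_right_mono) auto
        ultimately show ?thesis by simp
      qed
      then show "\<exists>d>0. \<forall>h. x + h \<in> Dm \<longrightarrow> norm h < d \<longrightarrow> f x + blinfun_apply p' h - e * norm h \<le> f (x + h)"
        using \<rho>(1)[of n] by (intro exI[of _ "real_of_rat (\<rho> n) / 2"]) auto
    qed
    then show ?thesis using p'(1) by blast
  qed
  show thesis using that[OF D sub] main unfolding Y_def by blast
qed

section \<open>Approximate subgradients\<close>

lemma approximate_minimum:
  fixes f :: "'a::banach \<Rightarrow> real" and \<phi> :: "nat \<Rightarrow> 'a \<Rightarrow> real"
  assumes x0: "x0 \<in> D" and nonneg: "\<forall>x\<in>D. 0 \<le> f x"
    and closed: "\<And>r. closed {x \<in> D. f x \<le> r}"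
    and c: "c > 0" and \<epsilon>: "\<epsilon> > 0"
    and lip: "\<And>n u v. \<bar>\<phi> n u - \<phi> n v\<bar> \<le> norm (u - v)" and zero: "\<And>n. \<phi> n 0 = 0"
    and low: "\<And>n z. norm z - \<epsilon> / c * (1 / 2) ^ n \<le> \<phi> n z"
  shows "\<exists>X x \<mu>. (\<forall>n. 0 < \<mu> n) \<and> \<mu> sums (c + \<epsilon>) \<and> (\<forall>n. X n \<in> D) \<and> x \<in> D \<and>
    f x + (c - \<epsilon>) * norm (x - x0) \<le> f x0 + \<epsilon> \<and> (\<forall>y. summable (\<lambda>n. \<mu> n * \<phi> n (y - X n))) \<and>
    (\<forall>y\<in>D. f x + (\<Sum>n. \<mu> n * \<phi> n (x - X n)) \<le> f y + (\<Sum>n. \<mu> n * \<phi> n (y - X n)))"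
proof -
  define \<mu> where "\<mu> n = (case n of 0 \<Rightarrow> c | Suc k \<Rightarrow> \<epsilon> * (1 / 2) ^ Suc k)" for n
  have \<mu>0: "\<mu> 0 = c" and \<mu>S: "\<mu> (Suc n) = \<epsilon> * (1 / 2) ^ Suc n" for n by (simp_all add: \<mu>_def)
  have \<mu>pos: "0 < \<mu> n" for n using c \<epsilon> by (cases n) (auto simp: \<mu>0 \<mu>S)
  have tail: "(\<lambda>n. \<mu> (Suc n)) sums \<epsilon>" using sums_mult[OF power_half_series, of \<epsilon>] unfolding \<mu>S by simp
  then have sums: "\<mu> sums (c + \<epsilon>)" using sums_Suc_iff[of \<mu> \<epsilon>] by (simp add: \<mu>0 add.commute)
  have ssum: "summable (\<lambda>n. \<epsilon> / c * (1 / 2) ^ n)" by (intro summable_mult summable_geometric) simp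
  have s0: "0 \<le> \<epsilon> / c * (1 / 2) ^ n" for n using c \<epsilon> by simp
  have "\<exists>X x. X 0 = x0 \<and> (\<forall>n. X n \<in> D) \<and> x \<in> D \<and> (\<forall>y. summable (\<lambda>n. \<mu> n * \<phi> n (y - X n))) \<and>
    (\<forall>y\<in>D. f x + (\<Sum>n. \<mu> n * \<phi> n (x - X n)) \<le> f y + (\<Sum>n. \<mu> n * \<phi> n (y - X n)))"
    by (rule perturbed_minimum[OF x0 nonneg closed \<mu>pos sums_summable[OF sums] s0 ssum lip zero low])
  then obtain X x where X0: "X 0 = x0" and X: "\<And>n. X n \<in> D" and x: "x \<in> D"
    and summ: "\<And>y. summable (\<lambda>n. \<mu> n * \<phi> n (y - X n))"
    and min: "\<And>y. y \<in> D \<Longrightarrow> f x + (\<Sum>n. \<mu> n * \<phi> n (x - X n)) \<le> f y + (\<Sum>n. \<mu> n * \<phi> n (y - X n))"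
    by blast
  have "f x + (c - \<epsilon>) * norm (x - x0) \<le> f x0 + \<epsilon>"
  proof -
    let ?T = "\<lambda>y. \<Sum>n. \<mu> (Suc n) * \<phi> (Suc n) (y - X (Suc n))"
    have st: "summable (\<lambda>n. \<mu> (Suc n) * \<phi> (Suc n) (y - X (Suc n)))" for y
      using summable_Suc_iff[of "\<lambda>n. \<mu> n * \<phi> n (y - X n)"] summ[of y] by simp
    have split: "(\<Sum>n. \<mu> n * \<phi> n (y - X n)) = ?T y + c * \<phi> 0 (y - x0)" for y
      using suminf_split_head[OF summ[of y]] by (simp add: \<mu>0 X0)
    have "?T x0 - ?T x = (\<Sum>n. \<mu> (Suc n) * (\<phi> (Suc n) (x0 - X (Suc n)) - \<phi> (Suc n) (x - X (Suc n))))"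
      using suminf_diff[OF st[of x0] st[of x]] by (simp add: right_diff_distrib)
    also have "\<dots> \<le> (\<Sum>n. \<mu> (Suc n) * norm (x - x0))"
    proof (rule suminf_le)
      show "summable (\<lambda>n. \<mu> (Suc n) * (\<phi> (Suc n) (x0 - X (Suc n)) - \<phi> (Suc n) (x - X (Suc n))))"
        using summable_diff[OF st[of x0] st[of x]] by (simp add: right_diff_distrib)
      show "summable (\<lambda>n. \<mu> (Suc n) * norm (x - x0))" by (intro summable_mult2 sums_summable[OF tail])
      fix n
      have "\<phi> (Suc n) (x0 - X (Suc n)) - \<phi> (Suc n) (x - X (Suc n)) \<le> norm (x - x0)"
        using lip[of "Suc n" "x0 - X (Suc n)" "x - X (Suc n)"] by (simp add: norm_minus_commute abs_le_iff)
      then show "\<mu> (Suc n) * (\<phi> (Suc n) (x0 - X (Suc n)) - \<phi> (Suc n) (x - X (Suc n))) \<le> \<mu> (Suc n) * norm (x - x0)"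
        using \<mu>pos[of "Suc n"] by simp
    qed
    also have "\<dots> = \<epsilon> * norm (x - x0)" using sums_unique[OF sums_mult2[OF tail, of "norm (x - x0)"]] by simp
    finally have T: "?T x0 - ?T x \<le> \<epsilon> * norm (x - x0)" .
    have "c * (norm (x - x0) - \<epsilon> / c) \<le> c * \<phi> 0 (x - x0)" using low[of "x - x0" 0] c by (intro mult_left_mono) auto
    then have "c * norm (x - x0) - \<epsilon> \<le> c * \<phi> 0 (x - x0)" using c by (simp add: right_diff_distrib)
    then show ?thesis using min[OF x0] T zero[of 0] unfolding split by (simp add: left_diff_distrib)
  qed
  then show ?thesis using \<mu>pos sums X x summ min
    by (intro exI[of _ X] exI[of _ x] exI[of _ \<mu>] conjI allI ballI)
qed

lemma approximate_subgradient_convex: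
  fixes f :: "'a::banach \<Rightarrow> real"
  assumes conv: "convex_on D f" and x0: "x0 \<in> D" and nonneg: "\<forall>x\<in>D. 0 \<le> f x"
    and closed: "\<And>r. closed {x \<in> D. f x \<le> r}"
    and c: "c > 0" and \<epsilon>: "\<epsilon> > 0"
  shows "\<exists>x\<in>D. \<exists>p. f x + (c - \<epsilon>) * norm (x - x0) \<le> f x0 + \<epsilon> \<and> norm p \<le> c + \<epsilon> \<and> frechet_subgradient D f x p"
proof -
  have lip: "\<bar>norm u - norm v\<bar> \<le> norm (u - v)" for u v :: 'a by (rule norm_triangle_ineq3)
  have low: "norm z - \<epsilon> / c * (1 / 2) ^ n \<le> norm z" for z :: 'a and n using c \<epsilon> by simp
  obtain X x \<mu> where \<mu>: "\<And>n. 0 < \<mu> n" "\<mu> sums (c + \<epsilon>)" and x: "x \<in> D"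
    and near: "f x + (c - \<epsilon>) * norm (x - x0) \<le> f x0 + \<epsilon>"
    and summ: "\<And>y. summable (\<lambda>n. \<mu> n * norm (y - X n))"
    and min: "\<And>y. y \<in> D \<Longrightarrow> f x + (\<Sum>n. \<mu> n * norm (x - X n)) \<le> f y + (\<Sum>n. \<mu> n * norm (y - X n))"
    using approximate_minimum[OF x0 nonneg closed c \<epsilon> lip norm_zero low] by blast
  have ek: "f x \<le> f y + (c + \<epsilon>) * norm (y - x)" if "y \<in> D" for y
  proof -
    have "(\<Sum>n. \<mu> n * norm (y - X n)) - (\<Sum>n. \<mu> n * norm (x - X n)) = (\<Sum>n. \<mu> n * (norm (y - X n) - norm (x - X n)))"
      using suminf_diff[OF summ[of y] summ[of x]] by (simp add: right_diff_distrib)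
    also have "\<dots> \<le> (\<Sum>n. \<mu> n * norm (y - x))"
    proof (rule suminf_le)
      show "summable (\<lambda>n. \<mu> n * (norm (y - X n) - norm (x - X n)))"
        using summable_diff[OF summ[of y] summ[of x]] by (simp add: right_diff_distrib)
      show "summable (\<lambda>n. \<mu> n * norm (y - x))" by (intro summable_mult2 sums_summable[OF \<mu>(2)])
      show "\<mu> n * (norm (y - X n) - norm (x - X n)) \<le> \<mu> n * norm (y - x)" for n
        using norm_triangle_ineq2[of "y - X n" "x - X n"] \<mu>(1)[of n] by simp
    qed
    also have "\<dots> = (c + \<epsilon>) * norm (y - x)" using sums_unique[OF sums_mult2[OF \<mu>(2)]] by simp
    finally show ?thesis using min[OF that] by linarith
  qed
  define E where "E = {(h, t). x + h \<in> D \<and> f (x + h) - f x \<le> t}"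
  have convE: "convex E"
    unfolding convex_def
  proof (intro ballI allI impI)
    fix a b and u v :: real assume "a \<in> E" "b \<in> E" and uv: "0 \<le> u" "0 \<le> v" "u + v = 1"
    then obtain h s k t where ab: "a = (h, s)" "b = (k, t)" "x + h \<in> D" "x + k \<in> D"
      "f (x + h) - f x \<le> s" "f (x + k) - f x \<le> t" by (auto simp: E_def)
    have "u *\<^sub>R x + v *\<^sub>R x = x" using uv(3) by (metis scaleR_add_left scaleR_one)
    moreover have "u *\<^sub>R (x + h) + v *\<^sub>R (x + k) = (u *\<^sub>R x + v *\<^sub>R x) + (u *\<^sub>R h + v *\<^sub>R k)"
      by (simp add: algebra_simps)
    ultimately have eq: "x + (u *\<^sub>R h + v *\<^sub>R k) = u *\<^sub>R (x + h) + v *\<^sub>R (x + k)" by simp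
    have "f (x + (u *\<^sub>R h + v *\<^sub>R k)) \<le> u * f (x + h) + v * f (x + k)"
      unfolding eq using conv ab(3,4) uv by (auto simp: convex_on_def)
    moreover have "u * (f (x + h) - f x) + v * (f (x + k) - f x) \<le> u * s + v * t"
      using ab uv by (intro add_mono mult_left_mono) auto
    moreover have "u * f x + v * f x = f x" using uv(3) by (metis distrib_right mult_1)
    ultimately have "f (x + (u *\<^sub>R h + v *\<^sub>R k)) - f x \<le> u * s + v * t"
      by (simp add: right_diff_distrib)
    moreover have "x + (u *\<^sub>R h + v *\<^sub>R k) \<in> D"
      unfolding eq using conv ab(3,4) uv by (auto simp: convex_on_def convex_def)
    ultimately show "u *\<^sub>R a + v *\<^sub>R b \<in> E" by (simp add: E_def ab)
  qed
  have ge: "- (c + \<epsilon>) * norm h \<le> t" if "(h, t) \<in> E" for h t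
    using that ek[of "x + h"] by (auto simp: E_def algebra_simps)
  have c\<epsilon>: "0 \<le> c + \<epsilon>" using c \<epsilon> by simp
  obtain p :: "'a \<Rightarrow>\<^sub>L real" where p: "norm p \<le> c + \<epsilon>" "\<And>h t. (h, t) \<in> E \<Longrightarrow> blinfun_apply p h \<le> t"
    using sandwich_functional[OF convE c\<epsilon> ge] by metis
  have "f x + blinfun_apply p h - e * norm h \<le> f (x + h)" if "x + h \<in> D" "e > 0" for h and e :: real
  proof -
    have "blinfun_apply p h \<le> f (x + h) - f x" using that by (intro p(2)) (auto simp: E_def)
    moreover have "0 \<le> e * norm h" using that by simp
    ultimately show ?thesis by linarith
  qed
  then have "frechet_subgradient D f x p"
    unfolding frechet_subgradient_def by (meson zero_less_one)
  then show ?thesis using x near p(1) by blast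
qed

lemma subgradient_of_smooth_minimum:
  fixes f :: "'a::real_normed_vector \<Rightarrow> real" and \<phi> :: "nat \<Rightarrow> 'a \<Rightarrow> real" and p :: "nat \<Rightarrow> ('a \<Rightarrow>\<^sub>L real)"
  assumes \<mu>: "\<And>n. 0 < \<mu> n" "\<mu> sums K" and Y: "subspace Y" and x: "x \<in> Y" and DY: "D \<subseteq> Y"
    and lip: "\<And>n u v. \<bar>\<phi> n u - \<phi> n v\<bar> \<le> norm (u - v)"
    and summ: "\<And>y. summable (\<lambda>n. \<mu> n * \<phi> n (y - X n))"
    and min: "\<forall>y\<in>D. f x + (\<Sum>n. \<mu> n * \<phi> n (x - X n)) \<le> f y + (\<Sum>n. \<mu> n * \<phi> n (y - X n))"
    and p: "\<And>n. norm (p n) \<le> 1"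
    and diff: "\<forall>n. \<forall>e>0. \<exists>d>0. \<forall>h\<in>Y. norm h < d \<longrightarrow>
      \<phi> n (x - X n + h) \<le> \<phi> n (x - X n) + blinfun_apply (p n) h + e * norm h"
  shows "\<exists>p'. norm p' \<le> K \<and> frechet_subgradient D f x p'"
proof -
  have K: "K > 0" using suminf_pos[OF sums_summable[OF \<mu>(2)] \<mu>(1)] sums_unique[OF \<mu>(2)] by simp
  have le: "norm (\<mu> n *\<^sub>R p n) \<le> \<mu> n" for n using \<mu>(1)[of n] p[of n] by (simp add: mult_left_le)
  have sn: "summable (\<lambda>n. norm (\<mu> n *\<^sub>R p n))"
    using le by (intro summable_comparison_test'[OF sums_summable[OF \<mu>(2)]]) auto
  define P where "P = (\<Sum>n. \<mu> n *\<^sub>R p n)"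
  have sp: "summable (\<lambda>n. \<mu> n *\<^sub>R p n)" by (rule summable_norm_cancel[OF sn])
  have "norm P \<le> (\<Sum>n. norm (\<mu> n *\<^sub>R p n))" unfolding P_def by (rule summable_norm[OF sn])
  also have "\<dots> \<le> K" using suminf_le[OF le sn sums_summable[OF \<mu>(2)]] sums_unique[OF \<mu>(2)] by simp
  finally have "norm (- P) \<le> K" by simp
  moreover have "frechet_subgradient D f x (- P)"
    unfolding frechet_subgradient_def
  proof (intro allI impI)
    fix e :: real assume e: "e > 0"
    obtain N where N: "\<And>n. n \<ge> N \<Longrightarrow> norm (\<Sum>i. \<mu> (i + n)) < e / 4"
      using suminf_exist_split[OF _ sums_summable[OF \<mu>(2)], of "e / 4"] e by auto
    have "\<forall>n. \<exists>d>0. \<forall>h\<in>Y. norm h < d \<longrightarrow> \<phi> n (x - X n + h) \<le> \<phi> n (x - X n) + blinfun_apply (p n) h + e / (2 * K) * norm h"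
      using diff e K by (metis divide_pos_pos mult_pos_pos zero_less_numeral)
    then obtain d where d: "\<And>n. d n > 0" "\<And>n h. h \<in> Y \<Longrightarrow> norm h < d n \<Longrightarrow>
      \<phi> n (x - X n + h) \<le> \<phi> n (x - X n) + blinfun_apply (p n) h + e / (2 * K) * norm h" by metis
    define m where "m = Min (insert 1 (d ` {..<N}))"
    have m: "m > 0" unfolding m_def using d(1) by (subst Min_gr_iff) auto
    have md: "m \<le> d n" if "n < N" for n unfolding m_def using that by (intro Min_le) auto
    have "f x + blinfun_apply (- P) h - e * norm h \<le> f (x + h)" if h: "x + h \<in> D" "norm h < m" for h
    proof -
      have hY: "h \<in> Y" using subspace_diff[OF Y subsetD[OF DY h(1)] x] by simp
      define g where "g n = \<phi> n (x + h - X n) - \<phi> n (x - X n) - blinfun_apply (p n) h" for n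
      have sph: "summable (\<lambda>n. \<mu> n * blinfun_apply (p n) h)" "blinfun_apply P h = (\<Sum>n. \<mu> n * blinfun_apply (p n) h)"
        using bounded_linear.summable[OF blinfun.bounded_linear_left sp, of h]
          bounded_linear.suminf[OF blinfun.bounded_linear_left sp, of h]
        by (simp_all add: P_def blinfun.scaleR_left)
      have geq: "\<mu> n * g n = \<mu> n * \<phi> n (x + h - X n) - \<mu> n * \<phi> n (x - X n) - \<mu> n * blinfun_apply (p n) h" for n
        by (simp add: g_def right_diff_distrib)
      have sg: "summable (\<lambda>n. \<mu> n * g n)" unfolding geq by (intro summable_diff summ sph)
      have Sg: "(\<Sum>n. \<mu> n * g n) = (\<Sum>n. \<mu> n * \<phi> n (x + h - X n)) - (\<Sum>n. \<mu> n * \<phi> n (x - X n)) - blinfun_apply P h"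
        unfolding geq sph(2) by (simp add: suminf_diff[symmetric] summ sph summable_diff)
      have g2: "g n \<le> 2 * norm h" for n
        using lip[of n "x + h - X n" "x - X n"] blinfun_apply_le_norm[OF p[of n], of h] by (simp add: g_def)
      have g1: "g n \<le> e / (2 * K) * norm h" if "n < N" for n
        using d(2)[OF hY less_le_trans[OF h(2) md[OF that]]] by (simp add: g_def algebra_simps)
      have "(\<Sum>n. \<mu> n * g n) = (\<Sum>n. \<mu> (n + N) * g (n + N)) + (\<Sum>n<N. \<mu> n * g n)"
        by (rule suminf_split_initial_segment[OF sg])
      also have "(\<Sum>n. \<mu> (n + N) * g (n + N)) \<le> (\<Sum>n. \<mu> (n + N) * (2 * norm h))"
      proof (rule suminf_le)
        show "summable (\<lambda>n. \<mu> (n + N) * g (n + N))"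
          using sg summable_iff_shift[of "\<lambda>n. \<mu> n * g n" N] by simp
        show "summable (\<lambda>n. \<mu> (n + N) * (2 * norm h))"
          using sums_summable[OF \<mu>(2)] summable_iff_shift[of \<mu> N] by (intro summable_mult2) simp
        show "\<mu> (n + N) * g (n + N) \<le> \<mu> (n + N) * (2 * norm h)" for n using g2 \<mu>(1) by simp
      qed
      also have "\<dots> = (\<Sum>n. \<mu> (n + N)) * (2 * norm h)"
        using sums_summable[OF \<mu>(2)] summable_iff_shift[of \<mu> N] by (intro suminf_mult2[symmetric]) simp
      also have "\<dots> \<le> e / 4 * (2 * norm h)" using N[of N] by (intro mult_right_mono) auto
      also have "(\<Sum>n<N. \<mu> n * g n) \<le> (\<Sum>n<N. \<mu> n * (e / (2 * K) * norm h))"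
        using g1 \<mu>(1) by (intro sum_mono mult_left_mono) (auto simp: less_imp_le)
      also have "\<dots> = (\<Sum>n<N. \<mu> n) * (e / (2 * K) * norm h)" by (rule sum_distrib_right[symmetric])
      also have "\<dots> \<le> K * (e / (2 * K) * norm h)"
        using sum_le_suminf[OF sums_summable[OF \<mu>(2)], of "{..<N}"] sums_unique[OF \<mu>(2)] \<mu>(1) e K
        by (intro mult_right_mono) (auto simp: less_imp_le)
      also have "e / 4 * (2 * norm h) + K * (e / (2 * K) * norm h) = e * norm h" using K by (simp add: field_simps)
      finally have "(\<Sum>n. \<mu> n * g n) \<le> e * norm h" by simp
      then show ?thesis using bspec[OF min h(1)] Sg by (simp add: blinfun.minus_left)
    qed
    then show "\<exists>d>0. \<forall>h. x + h \<in> D \<longrightarrow> norm h < d \<longrightarrow> f x + blinfun_apply (- P) h - e * norm h \<le> f (x + h)"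
      using m by blast
  qed
  ultimately show ?thesis by blast
qed

lemma approximate_subgradient_asplund:
  fixes f :: "'a::banach \<Rightarrow> real"
  assumes asp: "asplund TYPE('a)" and x0: "x0 \<in> D" and nonneg: "\<forall>x\<in>D. 0 \<le> f x"
    and closed: "\<And>r. closed {x \<in> D. f x \<le> r}"
    and c: "c > 0" and \<epsilon>: "\<epsilon> > 0"
  shows "\<exists>x\<in>D. \<exists>p. f x + (c - \<epsilon>) * norm (x - x0) \<le> f x0 + \<epsilon> \<and> norm p \<le> c + \<epsilon> \<and> frechet_subgradient D f x p"
proof -
  have c\<epsilon>: "0 \<le> c + \<epsilon>" using c \<epsilon> by simp
  obtain S where S: "countable S" "x0 \<in> S" "subspace (closure S)"
    and red: "\<And>x p. x \<in> closure S \<Longrightarrow> norm p \<le> c + \<epsilon> \<Longrightarrow> frechet_subgradient (D \<inter> closure S) f x p \<Longrightarrow>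
       \<exists>p'. norm p' \<le> c + \<epsilon> \<and> frechet_subgradient D f x p'"
    using separable_reduction[OF c\<epsilon>, of x0 D f] by metis
  define Y where "Y = closure S"
  obtain y where "dense_unit_sequence Y y"
    using dense_unit_sequence_exists[OF S(1) _ S(3)] S(2) unfolding Y_def by blast
  then interpret dense_unit_sequence Y y .
  have "\<exists>\<phi> :: 'a \<Rightarrow> real. \<phi> 0 = 0 \<and> (\<forall>a b. \<bar>\<phi> a - \<phi> b\<bar> \<le> norm (a - b)) \<and> (\<forall>z. norm z - s \<le> \<phi> z) \<and>
      (\<forall>x\<in>Y. \<exists>p. norm p \<le> 1 \<and> (\<forall>e>0. \<exists>d>0. \<forall>h\<in>Y. norm h < d \<longrightarrow> \<phi> (x + h) \<le> \<phi> x + blinfun_apply p h + e * norm h))"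
    if "s > 0" for s
    by (rule smooth_norm_approximation[OF asp that]) blast
  moreover have spos: "\<epsilon> / c * (1 / 2) ^ n > 0" for n using c \<epsilon> by simp
  ultimately have "\<forall>n. \<exists>\<phi> :: 'a \<Rightarrow> real. \<phi> 0 = 0 \<and> (\<forall>a b. \<bar>\<phi> a - \<phi> b\<bar> \<le> norm (a - b)) \<and> (\<forall>z. norm z - \<epsilon> / c * (1 / 2) ^ n \<le> \<phi> z) \<and>
      (\<forall>x\<in>Y. \<exists>p. norm p \<le> 1 \<and> (\<forall>e>0. \<exists>d>0. \<forall>h\<in>Y. norm h < d \<longrightarrow> \<phi> (x + h) \<le> \<phi> x + blinfun_apply p h + e * norm h))"
    by blast
  then obtain \<phi> :: "nat \<Rightarrow> 'a \<Rightarrow> real" where \<phi>: "\<And>n. \<phi> n 0 = 0" "\<And>n a b. \<bar>\<phi> n a - \<phi> n b\<bar> \<le> norm (a - b)"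
    "\<And>n z. norm z - \<epsilon> / c * (1 / 2) ^ n \<le> \<phi> n z"
    "\<And>n x. x \<in> Y \<Longrightarrow> \<exists>p. norm p \<le> 1 \<and> (\<forall>e>0. \<exists>d>0. \<forall>h\<in>Y. norm h < d \<longrightarrow> \<phi> n (x + h) \<le> \<phi> n x + blinfun_apply p h + e * norm h)"
    by metis
  have x0Y: "x0 \<in> D \<inter> Y" using x0 S(2) closure_subset[of S] by (auto simp: Y_def)
  have nonneg': "\<forall>x\<in>D \<inter> Y. 0 \<le> f x" using nonneg by simp
  have closed': "closed {x \<in> D \<inter> Y. f x \<le> r}" for r
  proof -
    have "{x \<in> D \<inter> Y. f x \<le> r} = {x \<in> D. f x \<le> r} \<inter> Y" by auto
    then show ?thesis using closed by (simp add: Y_def closed_Int)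
  qed
  obtain X x \<mu> where \<mu>: "\<And>n. 0 < \<mu> n" "\<mu> sums (c + \<epsilon>)" and X: "\<And>n. X n \<in> D \<inter> Y" and x: "x \<in> D \<inter> Y"
    and near: "f x + (c - \<epsilon>) * norm (x - x0) \<le> f x0 + \<epsilon>"
    and summ: "\<And>y. summable (\<lambda>n. \<mu> n * \<phi> n (y - X n))"
    and min: "\<forall>y\<in>D \<inter> Y. f x + (\<Sum>n. \<mu> n * \<phi> n (x - X n)) \<le> f y + (\<Sum>n. \<mu> n * \<phi> n (y - X n))"
    using approximate_minimum[OF x0Y nonneg' closed' c \<epsilon> \<phi>(2,1,3)] by blast
  have "x - X n \<in> Y" for n using subspace_diff[OF Y] x X[of n] by simp
  then have "\<forall>n. \<exists>p. norm p \<le> 1 \<and> (\<forall>e>0. \<exists>d>0. \<forall>h\<in>Y. norm h < d \<longrightarrow>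
      \<phi> n (x - X n + h) \<le> \<phi> n (x - X n) + blinfun_apply p h + e * norm h)"
    using \<phi>(4) by simp
  then obtain p where p: "\<And>n. norm (p n) \<le> 1" "\<forall>n. \<forall>e>0. \<exists>d>0. \<forall>h\<in>Y. norm h < d \<longrightarrow>
      \<phi> n (x - X n + h) \<le> \<phi> n (x - X n) + blinfun_apply (p n) h + e * norm h"
    by metis
  obtain p' where "norm p' \<le> c + \<epsilon>" "frechet_subgradient (D \<inter> Y) f x p'"
    using subgradient_of_smooth_minimum[OF \<mu> Y IntD2[OF x] Int_lower2 \<phi>(2) summ min p] by blast
  then show ?thesis using red[of x p'] x near unfolding Y_def by blast
qed

section \<open>The error bound\<close>

lemma ereal_lsc_open_superlevel:
  fixes f :: "'a::topological_space \<Rightarrow> ereal"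
  assumes "ereal_lsc f"
  shows "open {x. a < f x}"
proof (subst open_subopen, intro ballI)
  fix x assume "x \<in> {x. a < f x}"
  then have x: "a < f x" by simp
  also have "f x \<le> Liminf (at x) f" using assms by (simp add: ereal_lsc_def)
  finally have "\<forall>\<^sub>F y in at x. a < f y" by (rule less_LiminfD)
  then have "\<forall>\<^sub>F y in nhds x. a < f y" using x by (auto simp: eventually_at_filter elim: eventually_mono)
  then show "\<exists>T. open T \<and> x \<in> T \<and> T \<subseteq> {x. a < f x}" by (auto simp: eventually_nhds)
qed

lemma frechet_subdiffI:
  fixes f :: "'a::real_normed_vector \<Rightarrow> ereal"
  assumes fx: "f x = ereal a"
    and sub: "\<And>e. e > 0 \<Longrightarrow> \<exists>d>0. \<forall>h. norm h < d \<longrightarrow> ereal (a + blinfun_apply p h - e * norm h) \<le> f (x + h)"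
  shows "p \<in> frechet_subdiff f x"
proof -
  let ?q = "\<lambda>y. (f y - f x - ereal (blinfun_apply p (y - x))) / ereal (norm (y - x))"
  have "\<forall>\<^sub>F y in at x. b < ?q y" if b: "b < 0" for b
  proof -
    obtain e where e: "e > 0" "b < ereal (- e)"
    proof (cases b)
      case (real r)
      then show thesis using b that[of "- r / 2"] by simp
    next
      case MInf
      then show thesis using that[of 1] by simp
    qed (use b in auto)
    obtain d where d: "d > 0" "\<And>h. norm h < d \<Longrightarrow> ereal (a + blinfun_apply p h - e * norm h) \<le> f (x + h)"
      using sub[OF e(1)] by blast
    have "b < ?q y" if y: "y \<noteq> x" "norm (y - x) < d" for y
    proof -
      have n: "norm (y - x) > 0" using y by simp
      have le: "ereal (a + blinfun_apply p (y - x) - e * norm (y - x)) \<le> f y" using d(2)[OF y(2)] by simp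
      have "ereal (- e) \<le> ?q y"
      proof (cases "f y")
        case (real r)
        then have "- e * norm (y - x) \<le> r - a - blinfun_apply p (y - x)" using le by simp
        then have "- e \<le> (r - a - blinfun_apply p (y - x)) / norm (y - x)"
          using n by (simp add: pos_le_divide_eq)
        then show ?thesis using n by (simp add: real fx)
      next
        case PInf
        then show ?thesis using n by (simp add: fx)
      qed (use le in auto)
      then show ?thesis using e(2) by (rule less_le_trans[rotated])
    qed
    then show ?thesis using d(1) unfolding eventually_at by (auto simp: dist_norm)
  qed
  then have "0 \<le> Liminf (at x) ?q" by (simp add: le_Liminf_iff)
  then show ?thesis by (simp add: frechet_subdiff_def fx)
qed

lemma setdist_e_eq_infdist:
  assumes "A \<noteq> {}"
  shows "setdist_e x A = ereal (infdist x A)"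
proof -
  have "bdd_below (dist x ` A)" by (auto intro: bdd_belowI2[of _ 0])
  then show ?thesis
    using assms ereal_Inf'[of "dist x ` A"] by (simp add: setdist_e_def infdist_notempty image_image)
qed

lemma convex_on_positive_part:
  assumes conv: "ereal_convex f" and f: "\<forall>x. f x \<noteq> -\<infinity>"
  shows "convex_on {x. f x < \<infinity>} (\<lambda>x. real_of_ereal (max (f x) 0))"
proof -
  have le: "f ((1 - t) *\<^sub>R x + t *\<^sub>R y) \<le> ereal ((1 - t) * real_of_ereal (f x) + t * real_of_ereal (f y))"
    if "f x < \<infinity>" "f y < \<infinity>" "0 \<le> t" "t \<le> 1" for x y and t :: real
  proof -
    obtain a b where "f x = ereal a" "f y = ereal b"
      using \<open>f x < \<infinity>\<close> \<open>f y < \<infinity>\<close> f by (metis ereal_cases less_irrefl)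
    moreover have "f ((1 - t) *\<^sub>R x + t *\<^sub>R y) \<le> ereal (1 - t) * f x + ereal t * f y"
      using conv that(3,4) unfolding ereal_convex_def by blast
    ultimately show ?thesis by simp
  qed
  show ?thesis
  proof (rule convex_onI)
    show "convex {x. f x < \<infinity>}"
      unfolding convex_alt
    proof (intro ballI allI impI)
      fix x y and t :: real
      assume "x \<in> {x. f x < \<infinity>}" "y \<in> {x. f x < \<infinity>}" "0 \<le> t \<and> t \<le> 1"
      then have "f ((1 - t) *\<^sub>R x + t *\<^sub>R y) \<le> ereal ((1 - t) * real_of_ereal (f x) + t * real_of_ereal (f y))"
        by (intro le) auto
      then have "f ((1 - t) *\<^sub>R x + t *\<^sub>R y) < \<infinity>" by (rule le_less_trans) simp
      then show "(1 - t) *\<^sub>R x + t *\<^sub>R y \<in> {x. f x < \<infinity>}" by simp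
    qed
    fix t :: real and x y assume t: "0 < t" "t < 1" and xy: "x \<in> {x. f x < \<infinity>}" "y \<in> {x. f x < \<infinity>}"
    let ?z = "(1 - t) *\<^sub>R x + t *\<^sub>R y"
    have m: "real_of_ereal (max (f w) 0) = max (real_of_ereal (f w)) 0" if "f w < \<infinity>" for w
      using that f by (cases "f w") (auto simp: max_def)
    have z: "f ?z \<le> ereal ((1 - t) * real_of_ereal (f x) + t * real_of_ereal (f y))"
      using le[of x y t] t xy by simp
    then have zfin: "f ?z < \<infinity>" by (rule le_less_trans) simp
    then have "real_of_ereal (f ?z) \<le> (1 - t) * real_of_ereal (f x) + t * real_of_ereal (f y)"
      using z f by (cases "f ?z") auto
    also have "\<dots> \<le> (1 - t) * max (real_of_ereal (f x)) 0 + t * max (real_of_ereal (f y)) 0"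
      using t by (intro add_mono mult_left_mono) auto
    finally show "real_of_ereal (max (f ?z) 0) \<le> (1 - t) * real_of_ereal (max (f x) 0) + t * real_of_ereal (max (f y) 0)"
      using m[of x] m[of y] m[OF zfin] xy t by simp
  qed
qed

theorem theorem3p4:
  fixes f :: "'a::banach \<Rightarrow> ereal" and xbar :: 'a and \<tau> :: real and \<delta> :: ereal
  assumes f_range: "\<forall>x. f x \<noteq> -\<infinity>"
    and f_lsc: "ereal_lsc f"
    and xbar: "f xbar \<le> 0"
    and tau: "\<tau> > 0"
    and delta: "\<delta> > 0"
    and asp_or_conv: "asplund TYPE('a) \<or> ereal_convex f"
    and slope: "\<forall>x \<in> eball xbar \<delta>. f x > 0 \<longrightarrow> f x < ereal \<tau> * setdist_e x {y. f y \<le> 0}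
                   \<longrightarrow> subdiff_dist0 f x \<ge> ereal \<tau>"
  shows "\<forall>\<alpha>::real. 0 < \<alpha> \<and> \<alpha> \<le> 1 \<longrightarrow>
           (\<forall>x \<in> eball xbar (\<delta> / ereal (1 + \<alpha>)).
              ereal (\<alpha> * \<tau>) * setdist_e x {y. f y \<le> 0} \<le> max (f x) 0)"
proof (intro allI impI ballI, rule ccontr)
  fix \<alpha> :: real and x0
  assume \<alpha>: "0 < \<alpha> \<and> \<alpha> \<le> 1" and x0: "x0 \<in> eball xbar (\<delta> / ereal (1 + \<alpha>))"
  define S where "S = {y. f y \<le> 0}"
  have xS: "xbar \<in> S" using xbar by (simp add: S_def)
  have sd: "setdist_e x S = ereal (infdist x S)" for x using xS by (intro setdist_e_eq_infdist) auto
  define D where "D = {x. f x < \<infinity>}"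
  define G where "G x = real_of_ereal (max (f x) 0)" for x
  define R where "R = infdist x0 S"
  assume "\<not> ereal (\<alpha> * \<tau>) * setdist_e x0 {y. f y \<le> 0} \<le> max (f x0) 0"
  then have lt: "max (f x0) 0 < ereal (\<alpha> * \<tau> * R)" by (simp add: not_le S_def[symmetric] sd R_def del: max_less_iff_conj)
  have fG: "f x = ereal (G x)" if "f x < \<infinity>" "0 < f x" for x
    using that by (cases "f x") (auto simp: G_def max_def)
  have GD: "max (f x) 0 = ereal (G x)" if "x \<in> D" for x
    using that f_range by (cases "f x") (auto simp: G_def D_def max_def)
  have x0D: "x0 \<in> D" using lt by (auto simp: D_def max_def split: if_splits intro: less_trans)
  have G0: "G x0 < \<alpha> * \<tau> * R" using lt GD[OF x0D] by simp
  have nonneg: "\<forall>x\<in>D. 0 \<le> G x" by (auto simp: G_def real_of_ereal_pos)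
  have closed: "closed {x \<in> D. G x \<le> r}" for r
  proof (cases "r \<ge> 0")
    case True
    have "{x \<in> D. G x \<le> r} = - {x. ereal r < f x}"
    proof (intro set_eqI)
      fix x
      show "x \<in> {x \<in> D. G x \<le> r} \<longleftrightarrow> x \<in> - {x. ereal r < f x}"
        using True f_range by (cases "f x") (auto simp: D_def G_def max_def)
    qed
    then show ?thesis using ereal_lsc_open_superlevel[OF f_lsc, of "ereal r"] by (simp add: closed_def)
  next
    case False
    then have "{x \<in> D. G x \<le> r} = {}" using nonneg by force
    then show ?thesis by (simp only: closed_empty)
  qed
  have Rpos: "R > 0"
  proof -
    have "0 < \<alpha> * \<tau> * R" using G0 nonneg x0D by force
    then show ?thesis using \<alpha> tau zero_less_mult_pos[of "\<alpha> * \<tau>" R] by simp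
  qed
  define gap where "gap = \<alpha> * \<tau> * R - G x0"
  define m where "m = 1 + 3 * \<alpha> * R"
  define \<epsilon> where "\<epsilon> = min (\<tau> / 4) (gap / (2 * m))"
  define c where "c = \<tau> - 2 * \<epsilon>"
  have den: "m > 0" using \<alpha> Rpos by (simp add: m_def add_pos_pos)
  have gap: "gap > 0" using G0 by (simp add: gap_def)
  have \<epsilon>: "\<epsilon> > 0" "\<epsilon> \<le> \<tau> / 4" "\<epsilon> \<le> gap / (2 * m)"
    using gap den tau unfolding \<epsilon>_def min_less_iff_conj by (simp_all only: min.cobounded1 min.cobounded2) simp
  have c: "c > 0" "c - \<epsilon> > 0" "c + \<epsilon> < \<tau>" using \<epsilon> tau by (auto simp: c_def)
  have "\<epsilon> * m \<le> gap / (2 * m) * m"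
    using den \<epsilon>(3) by (intro mult_right_mono) auto
  also have "\<dots> = gap / 2" using den by simp
  also have "\<dots> < gap" using gap by simp
  finally have start: "G x0 + \<epsilon> < (c - \<epsilon>) * (\<alpha> * R)" by (simp add: m_def gap_def c_def algebra_simps)
  have "\<exists>x\<in>D. \<exists>p. G x + (c - \<epsilon>) * norm (x - x0) \<le> G x0 + \<epsilon> \<and> norm p \<le> c + \<epsilon> \<and> frechet_subgradient D G x p"
    using asp_or_conv
  proof
    assume "asplund TYPE('a)"
    then show ?thesis by (rule approximate_subgradient_asplund[OF _ x0D nonneg closed c(1) \<epsilon>(1)])
  next
    assume "ereal_convex f"
    then have "convex_on D G" using convex_on_positive_part[OF _ f_range] unfolding D_def G_def by blast
    then show ?thesis by (rule approximate_subgradient_convex[OF _ x0D nonneg closed c(1) \<epsilon>(1)])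
  qed
  then obtain x p where x: "x \<in> D" "G x + (c - \<epsilon>) * norm (x - x0) \<le> G x0 + \<epsilon>"
    and p: "norm p \<le> c + \<epsilon>" "frechet_subgradient D G x p" by blast
  have lt1: "G x + (c - \<epsilon>) * norm (x - x0) < (c - \<epsilon>) * (\<alpha> * R)" using x(2) start by linarith
  then have "(c - \<epsilon>) * norm (x - x0) < (c - \<epsilon>) * (\<alpha> * R)" using nonneg x(1) by force
  then have near: "norm (x - x0) < \<alpha> * R" using c(2) by simp
  have \<alpha>R: "\<alpha> * R \<le> R" using \<alpha> Rpos by (simp add: mult_left_le_one_le)
  have Rx: "R \<le> infdist x S + norm (x - x0)"
    using infdist_triangle[of x0 S x] by (simp add: R_def dist_norm norm_minus_commute)
  then have "infdist x S > 0" using near \<alpha>R by linarith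
  then have "x \<notin> S" by auto
  then have fpos: "0 < f x" by (auto simp: S_def)
  have fx: "f x = ereal (G x)" using fG[OF _ fpos] x(1) by (simp add: D_def)
  have "x \<in> eball xbar \<delta>"
  proof -
    have R_le: "R \<le> dist xbar x0" using infdist_le[OF xS, of x0] by (simp add: R_def dist_commute)
    have "dist xbar x \<le> dist xbar x0 + norm (x - x0)"
      using dist_triangle[of xbar x x0] by (simp add: dist_norm norm_minus_commute)
    also have "\<dots> < dist xbar x0 + \<alpha> * R" using near by simp
    also have "\<dots> \<le> (1 + \<alpha>) * dist xbar x0" using R_le \<alpha> by (simp add: distrib_right)
    finally have d: "dist xbar x < (1 + \<alpha>) * dist xbar x0" .
    show ?thesis
    proof (cases \<delta>)
      case (real d')
      then have "dist xbar x0 < d' / (1 + \<alpha>)" using x0 \<alpha> by (simp add: eball_def)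
      then have "(1 + \<alpha>) * dist xbar x0 < d'" using \<alpha> by (simp add: field_simps)
      then show ?thesis using d by (simp add: eball_def real)
    qed (use delta in \<open>auto simp: eball_def\<close>)
  qed
  moreover have "f x < ereal \<tau> * setdist_e x {y. f y \<le> 0}"
  proof -
    have "G x < (c - \<epsilon>) * (\<alpha> * R - norm (x - x0))" using lt1 by (simp add: algebra_simps)
    also have "\<dots> \<le> (c - \<epsilon>) * infdist x S" using Rx \<alpha>R c(2) by (intro mult_left_mono) auto
    also have "\<dots> \<le> \<tau> * infdist x S" using c(3) \<epsilon>(1) infdist_nonneg[of x S] by (intro mult_right_mono) auto
    finally show ?thesis by (simp add: S_def[symmetric] sd fx)
  qed
  ultimately have "ereal \<tau> \<le> subdiff_dist0 f x" using slope fpos by blast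
  moreover have "subdiff_dist0 f x \<le> ereal (norm p)"
    unfolding subdiff_dist0_def
  proof (rule INF_lower, rule frechet_subdiffI[where f = f and x = x, OF fx])
    fix e :: real assume "e > 0"
    then obtain d where d: "d > 0"
      "\<And>h. x + h \<in> D \<Longrightarrow> norm h < d \<Longrightarrow> G x + blinfun_apply p h - e * norm h \<le> G (x + h)"
      using p(2) unfolding frechet_subgradient_def by blast
    have "open {y. 0 < f y}" by (rule ereal_lsc_open_superlevel[OF f_lsc])
    then obtain d' where d': "d' > 0" "\<And>y. dist y x < d' \<Longrightarrow> 0 < f y"
      using fpos unfolding open_dist by auto
    have "ereal (G x + blinfun_apply p h - e * norm h) \<le> f (x + h)" if h: "norm h < min d d'" for h
    proof (cases "f (x + h) < \<infinity>")
      case True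
      have "0 < f (x + h)" using d'(2)[of "x + h"] h by (simp add: dist_norm)
      then have "f (x + h) = ereal (G (x + h))" using fG True by blast
      then show ?thesis using d(2)[of h] h True by (simp add: D_def)
    qed auto
    then show "\<exists>d>0. \<forall>h. norm h < d \<longrightarrow> ereal (G x + blinfun_apply p h - e * norm h) \<le> f (x + h)"
      using d(1) d'(1) by (intro exI[of _ "min d d'"]) auto
  qed
  ultimately have "ereal \<tau> \<le> ereal (norm p)" by (rule order_trans)
  then show False using p(1) c(3) by simp
qed

end
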